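(* For every integer $t\ge 3$, the Strong Ramsey game $\mathcal{R}(K_{\aleph_0}^{(3)}, K^{(3)}_{2,t+1}(t-2))$ is a draw; that is, $P_2$ has a strategy guaranteeing that $P_1$ never claims all edges of a copy of $K^{(3)}_{2,t+1}(t-2)$.
   Context: Strong Ramsey game $\mathcal{R}(B,G)$: $B$ (possibly infinite) and $G$ (finite) are $k$-uniform hypergraphs; players $P_1$ and $P_2$ alternately claim a previously unclaimed edge of $B$, $P_1$ first; the first to claim all edges of a copy of $G$ in $B$ wins; if neither does so after finitely many moves, the game is a draw. $K_{\aleph_0}^{(3)}$ is the complete $3$-uniform hypergraph on a countably infinite vertex set. For $s\ge0$, $t\ge3$, $K_{2,t}(s)$ is the graph obtained from $K_{2,t}$ by identifying the center of a star with $s$ leaves (the leaves being new vertices) with one of the two vertices of degree $t$. For a graph $H$, $H^{(3)}$ is the $3$-uniform hypergraph obtained by adding one fixed new vertex (the center) to every edge of $H$. *)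

theory Defs
  imports Main
begin

text \<open>Vertices of K_{2,t}(s): the two vertices of degree t (HubA, HubB),
  the t common neighbours Mid 0..Mid (t-1), and the s star leaves Leaf 0..Leaf (s-1),
  attached to HubA (the centre of the star is identified with HubA).\<close>
datatype kv = HubA | HubB | Mid nat | Leaf nat

definition K2ts :: "nat \<Rightarrow> nat \<Rightarrow> kv set set" where
  "K2ts t s = {{HubA, Mid i} | i. i < t} \<union> {{HubB, Mid i} | i. i < t}
              \<union> {{HubA, Leaf j} | j. j < s}"

definition cone3 :: "'a set set \<Rightarrow> 'a option set set" where
  "cone3 E = (\<lambda>e. insert None (Some ` e)) ` E"

text \<open>S (a set of 3-edges on nat) contains a copy of the hypergraph G (given by its
  edge set; G has no isolated vertices).\<close>
definition contains_copy :: "'v set set \<Rightarrow> nat set set \<Rightarrow> bool" where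
  "contains_copy G S \<longleftrightarrow> (\<exists>\<phi>. inj_on \<phi> (\<Union>G) \<and> (\<forall>e\<in>G. \<phi> ` e \<in> S))"

definition board3 :: "nat set set" where
  "board3 = {e. card e = 3}"

definition legal_play :: "(nat \<Rightarrow> nat set) \<Rightarrow> bool" where
  "legal_play p \<longleftrightarrow> (\<forall>i. p i \<in> board3 \<and> p i \<notin> p ` {..<i})"

definition P1_edges :: "(nat \<Rightarrow> nat set) \<Rightarrow> nat \<Rightarrow> nat set set" where
  "P1_edges p n = {p i | i. i \<le> n \<and> even i}"

definition P2_edges :: "(nat \<Rightarrow> nat set) \<Rightarrow> nat \<Rightarrow> nat set set" where
  "P2_edges p n = {p i | i. i \<le> n \<and> odd i}"

text \<open>P1 wins the play: at some move n of P1 he completes a copy of G, and P2 has not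
  completed a copy at any earlier move (which would have ended the game).\<close>
definition P1_wins :: "'v set set \<Rightarrow> (nat \<Rightarrow> nat set) \<Rightarrow> bool" where
  "P1_wins G p \<longleftrightarrow> (\<exists>n. even n \<and> contains_copy G (P1_edges p n) \<and>
      \<not> (\<exists>m<n. odd m \<and> contains_copy G (P2_edges p m)))"

definition legal_P2_strategy :: "(nat set list \<Rightarrow> nat set) \<Rightarrow> bool" where
  "legal_P2_strategy \<sigma> \<longleftrightarrow>
     (\<forall>h. odd (length h) \<and> distinct h \<and> set h \<subseteq> board3 \<longrightarrow>
          \<sigma> h \<in> board3 \<and> \<sigma> h \<notin> set h)"

definition follows_P2 :: "(nat set list \<Rightarrow> nat set) \<Rightarrow> (nat \<Rightarrow> nat set) \<Rightarrow> bool" where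
  "follows_P2 \<sigma> p \<longleftrightarrow> (\<forall>i. odd i \<longrightarrow> p i = \<sigma> (map p [0..<i]))"

end

theory Submission
  imports Defs
begin

text \<open>
  A copy of the target has a centre \<open>z\<close>, two hubs \<open>x\<close>, \<open>y\<close>, a set \<open>M\<close> of \<open>t + 1\<close> middle vertices and a set \<open>L\<close> of
  \<open>t - 2\<close> leaves at \<open>x\<close>. The second player first builds a star of \<open>2 * t - 1\<close> edges \<open>{p, q, w}\<close>, away from
  the first edge of his opponent. He then takes a fresh vertex \<open>b\<close> and claims edges \<open>{p, b, w}\<close> over the leaves
  \<open>w\<close> of the star. With \<open>t\<close> of them and one more available he wins, so the opponent has to spend all but one of
  his moves on blocking. Once the opponent holds the remaining \<open>t - 1\<close> such edges, every edge \<open>{p, q, v}\<close> with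
  fresh \<open>v\<close> is a threat whose only answer \<open>{p, b, v}\<close> is useless to the opponent, and threatening forever draws.

  The opponent can only be faster if his \<open>2 * t\<close> edges at the end of the star phase all lie in one copy, with
  centre \<open>c\<close> and hubs \<open>a\<close>, \<open>d\<close>, say. In that case the number of his edges \<open>{c, a, v}\<close>, \<open>{c, d, v}\<close> whose partner
  (swap \<open>a\<close> and \<open>d\<close>) is not yet taken by the second player is \<open>2 * t\<close> at most. Whenever it becomes \<open>2 * t + 1\<close>,
  it is odd, so some such edge has an unclaimed partner, which the second player takes. Thus \<open>a\<close> and \<open>d\<close> never
  acquire more than \<open>t\<close> common neighbours in the link of \<open>c\<close>.
\<close>

section \<open>Copies of the target\<close>

definition copy_shape :: "nat \<Rightarrow> nat \<Rightarrow> nat \<Rightarrow> nat \<Rightarrow> nat \<Rightarrow> nat set \<Rightarrow> nat set \<Rightarrow> bool" where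
  "copy_shape n s z x y M L \<longleftrightarrow> z \<noteq> x \<and> z \<noteq> y \<and> x \<noteq> y \<and> {z, x, y} \<inter> (M \<union> L) = {} \<and> M \<inter> L = {} \<and>
     finite M \<and> finite L \<and> card M = n \<and> card L = s"

definition copy_edges :: "nat \<Rightarrow> nat \<Rightarrow> nat \<Rightarrow> nat set \<Rightarrow> nat set \<Rightarrow> nat set set" where
  "copy_edges z x y M L = (\<lambda>m. {z, x, m}) ` (M \<union> L) \<union> (\<lambda>m. {z, y, m}) ` M"

lemma Union_cone3_K2ts:
  assumes "n > 0"
  shows "\<Union> (cone3 (K2ts n s)) =
    insert None (Some ` ({HubA, HubB} \<union> Mid ` {..<n} \<union> Leaf ` {..<s}))" (is "?l = ?r")
proof
  show "?l \<subseteq> ?r" by (auto simp: cone3_def K2ts_def)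
  have A: "{HubA, Mid i} \<in> K2ts n s" "{HubB, Mid i} \<in> K2ts n s" if "i < n" for i
    using that by (auto simp: K2ts_def)
  have B: "{HubA, Leaf i} \<in> K2ts n s" if "i < s" for i
    using that by (auto simp: K2ts_def)
  have C: "insert None (Some ` e) \<subseteq> ?l" if "e \<in> K2ts n s" for e
    using that by (auto simp: cone3_def)
  show "?r \<subseteq> ?l"
    using C[OF A(1)[OF assms]] C[OF A(2)[OF assms]] C[OF A(1)] C[OF B] by auto
qed

text \<open>An embedding matters only through the images of the centre and the hubs and through the
  two image sets of middle vertices and leaves, so later arguments can work with \<open>M\<close>
  and \<open>L\<close> instead of an injection. The assumption \<open>n > 0\<close> ensures that
  both hubs lie on edges, so that injectivity on the union of the edges speaks about them.\<close>

lemma contains_copy_iff: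
  assumes "n > 0"
  shows "contains_copy (cone3 (K2ts n s)) X \<longleftrightarrow>
    (\<exists>z x y M L. copy_shape n s z x y M L \<and> copy_edges z x y M L \<subseteq> X)"
proof
  assume "contains_copy (cone3 (K2ts n s)) X"
  then obtain \<phi> where inj: "inj_on \<phi> (\<Union> (cone3 (K2ts n s)))"
    and X: "\<And>e. e \<in> K2ts n s \<Longrightarrow> \<phi> ` insert None (Some ` e) \<in> X"
    unfolding contains_copy_def cone3_def by auto
  define M where "M = (\<lambda>i. \<phi> (Some (Mid i))) ` {..<n}"
  define L where "L = (\<lambda>i. \<phi> (Some (Leaf i))) ` {..<s}"
  note inj' = inj[unfolded Union_cone3_K2ts[OF assms]]
  have eq: "\<phi> u = \<phi> v \<longleftrightarrow> u = v"
    if "u \<in> insert None (Some ` ({HubA, HubB} \<union> Mid ` {..<n} \<union> Leaf ` {..<s}))"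
      "v \<in> insert None (Some ` ({HubA, HubB} \<union> Mid ` {..<n} \<union> Leaf ` {..<s}))" for u v
    using inj_on_eq_iff[OF inj' that] .
  have cM: "card M = n" unfolding M_def
    by (subst card_image) (auto simp: inj_on_def eq)
  have cL: "card L = s" unfolding L_def
    by (subst card_image) (auto simp: inj_on_def eq)
  have "copy_shape n s (\<phi> None) (\<phi> (Some HubA)) (\<phi> (Some HubB)) M L"
    unfolding copy_shape_def using cM cL by (auto simp: M_def L_def eq)
  moreover have "copy_edges (\<phi> None) (\<phi> (Some HubA)) (\<phi> (Some HubB)) M L \<subseteq> X"
  proof -
    have "\<phi> ` insert None (Some ` {HubA, Mid i}) \<in> X" "\<phi> ` insert None (Some ` {HubB, Mid i}) \<in> X"
      if "i < n" for i by (rule X; use that in \<open>auto simp: K2ts_def\<close>)+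
    moreover have "\<phi> ` insert None (Some ` {HubA, Leaf i}) \<in> X" if "i < s" for i
      by (rule X; use that in \<open>auto simp: K2ts_def\<close>)
    ultimately show ?thesis by (auto simp: copy_edges_def M_def L_def)
  qed
  ultimately show "\<exists>z x y M L. copy_shape n s z x y M L \<and> copy_edges z x y M L \<subseteq> X" by blast
next
  assume "\<exists>z x y M L. copy_shape n s z x y M L \<and> copy_edges z x y M L \<subseteq> X"
  then obtain z x y M L where S: "copy_shape n s z x y M L" and E: "copy_edges z x y M L \<subseteq> X" by blast
  obtain f where f: "bij_betw f {..<n} M"
    using S ex_bij_betw_nat_finite[of M] by (auto simp: copy_shape_def atLeast0LessThan)
  obtain g where g: "bij_betw g {..<s} L"
    using S ex_bij_betw_nat_finite[of L] by (auto simp: copy_shape_def atLeast0LessThan)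
  define \<phi> where "\<phi> u = (case u of None \<Rightarrow> z | Some HubA \<Rightarrow> x | Some HubB \<Rightarrow> y
    | Some (Mid i) \<Rightarrow> f i | Some (Leaf j) \<Rightarrow> g j)" for u
  have fM: "f i \<in> M" if "i < n" for i using f that by (auto simp: bij_betw_def)
  have gL: "g i \<in> L" if "i < s" for i using g that by (auto simp: bij_betw_def)
  have fi: "f i = f j \<longleftrightarrow> i = j" if "i < n" "j < n" for i j
    using f that by (auto simp: bij_betw_def inj_on_def)
  have gi: "g i = g j \<longleftrightarrow> i = j" if "i < s" "j < s" for i j
    using g that by (auto simp: bij_betw_def inj_on_def)
  have ne: "f i \<noteq> g j" "z \<noteq> f i" "z \<noteq> g j" "x \<noteq> f i" "x \<noteq> g j" "y \<noteq> f i" "y \<noteq> g j"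
    if "i < n" "j < s" for i j
    using S fM[OF that(1)] gL[OF that(2)] by (auto simp: copy_shape_def)
  have nf: "z \<noteq> f i" "x \<noteq> f i" "y \<noteq> f i" if "i < n" for i
    using S fM[OF that(1)] by (auto simp: copy_shape_def)
  have ng: "z \<noteq> g i" "x \<noteq> g i" "y \<noteq> g i" if "i < s" for i
    using S gL[OF that(1)] by (auto simp: copy_shape_def)
  have d: "z \<noteq> x" "z \<noteq> y" "x \<noteq> y" using S by (auto simp: copy_shape_def)
  have "inj_on \<phi> (\<Union> (cone3 (K2ts n s)))"
    unfolding Union_cone3_K2ts[OF assms]
    by (rule inj_onI) (auto simp: \<phi>_def fi gi ne nf ng d ne[symmetric] nf[symmetric] ng[symmetric] d[symmetric])
  moreover have "\<phi> ` insert None (Some ` e) \<in> X" if e: "e \<in> K2ts n s" for e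
  proof -
    have "{z, x, f i} \<in> X" "{z, y, f i} \<in> X" if "i < n" for i
      using E fM[OF that] by (auto simp: copy_edges_def)
    moreover have "{z, x, g i} \<in> X" if "i < s" for i
      using E gL[OF that] by (auto simp: copy_edges_def)
    ultimately show ?thesis
      using e by (auto simp: K2ts_def \<phi>_def)
  qed
  ultimately show "contains_copy (cone3 (K2ts n s)) X"
    unfolding contains_copy_def cone3_def by (intro exI[of _ \<phi>]) auto
qed

lemma card_triples:
  assumes "z \<notin> M" "x \<notin> M"
  shows "card ((\<lambda>m. {z, x, m}) ` M) = card M"
  by (rule card_image) (use assms in \<open>auto simp: inj_on_def\<close>)

text \<open>The hub \<open>x\<close> separates the two families of edges: it lies in every edge of
  the first and in none of the second. For the target the count is
  \<open>2 * (t + 1) + (t - 2) = 3 * t\<close>.\<close>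

lemma card_copy_edges:
  assumes "copy_shape n s z x y M L"
  shows "card (copy_edges z x y M L) = 2 * n + s"
proof -
  have "(\<lambda>m. {z, x, m}) ` (M \<union> L) \<inter> (\<lambda>m. {z, y, m}) ` M = {}"
  proof -
    have "{z, x, m} \<noteq> {z, y, m'}" if "m \<in> M \<union> L" "m' \<in> M" for m m'
    proof -
      have "x \<notin> {z, y, m'}" using assms that by (auto simp: copy_shape_def)
      then show ?thesis by blast
    qed
    then show ?thesis by blast
  qed
  then have "card (copy_edges z x y M L) = card (M \<union> L) + card M"
    unfolding copy_edges_def using assms
    by (subst card_Un_disjoint) (auto simp: copy_shape_def card_triples)
  also have "card (M \<union> L) = n + s"
    using assms by (subst card_Un_disjoint) (auto simp: copy_shape_def)
  finally show ?thesis using assms by (simp add: copy_shape_def)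
qed

section \<open>Strategies from invariants of positions\<close>

lemma infinite_board3: "infinite board3"
proof
  assume fin: "finite board3"
  have inj: "inj (\<lambda>n::nat. {n, Suc n, Suc (Suc n)})"
    by (rule inj_on_inverseI[where g = Min]) simp
  have "range (\<lambda>n::nat. {n, Suc n, Suc (Suc n)}) \<subseteq> board3"
    by (auto simp: board3_def)
  then have "finite (range (\<lambda>n::nat. {n, Suc n, Suc (Suc n)}))"
    using fin finite_subset by blast
  then show False using inj finite_imageD infinite_UNIV_nat by blast
qed

text \<open>The invariant describes positions with the first player to move and sees only the two
  edge sets; the strategy recovers them from the parity of the places in the history and chooses a
  reply that restores \<open>I\<close>. A copy of the first player is tolerated when the second
  player already has one, because the game has ended by then.\<close>

lemma P2_strategy_from_invariant:
  fixes G :: "'v set set" and I :: "nat set set \<Rightarrow> nat set set \<Rightarrow> bool"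
  assumes init: "I {} {}" and nonempty: "G \<noteq> {}"
    and step: "\<And>X Y e. \<lbrakk>I X Y; finite X; finite Y; X \<subseteq> board3; Y \<subseteq> board3; X \<inter> Y = {};
        e \<in> board3; e \<notin> X \<union> Y\<rbrakk> \<Longrightarrow>
      (contains_copy G (insert e X) \<longrightarrow> contains_copy G Y) \<and>
      (\<exists>e'\<in>board3. e' \<notin> insert e X \<union> Y \<and> I (insert e X) (insert e' Y))"
  shows "\<exists>\<sigma>. legal_P2_strategy \<sigma> \<and>
    (\<forall>p. legal_play p \<and> follows_P2 \<sigma> p \<longrightarrow> \<not> P1_wins G p)"
proof -
  define xs where "xs h = (!) h ` {i. i < length h \<and> even i}" for h :: "nat set list"
  define ys where "ys h = (!) h ` {i. i < length h \<and> odd i}" for h :: "nat set list"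
  define good where "good h e \<longleftrightarrow> e \<in> board3 \<and> e \<notin> set h \<and> I (xs h) (insert e (ys h))" for h e
  \<comment> \<open>The second branch serves legality on arbitrary histories; plays that follow
    \<open>\<sigma>\<close> always reach the first one.\<close>
  define \<sigma> where "\<sigma> h = (if \<exists>e. good h e then SOME e. good h e
     else SOME e. e \<in> board3 \<and> e \<notin> set h)" for h
  have free: "\<exists>e. e \<in> board3 \<and> e \<notin> set h" for h
    using infinite_board3 by (meson finite_set finite_subset subsetI)
  have legal: "\<sigma> h \<in> board3 \<and> \<sigma> h \<notin> set h" for h
  proof (cases "\<exists>e. good h e")
    case True
    then have "good h (\<sigma> h)" unfolding \<sigma>_def using someI_ex[of "good h"] by simp
    then show ?thesis by (simp add: good_def)
  next
    case False
    then show ?thesis unfolding \<sigma>_def using someI_ex[OF free[of h]] by auto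
  qed
  have good: "good h (\<sigma> h)" if "good h e" for h e
    using that someI_ex[of "good h"] by (auto simp: \<sigma>_def)
  have "\<not> P1_wins G p" if lp: "legal_play p" and fo: "follows_P2 \<sigma> p" for p
  proof
    assume win: "P1_wins G p"
    define X where "X k = p ` {i. i < 2 * k \<and> even i}" for k
    define Y where "Y k = p ` {i. i < 2 * k \<and> odd i}" for k
    have b: "p i \<in> board3" for i using lp by (auto simp: legal_play_def)
    have less: "p i \<noteq> p j" if "i < j" for i j
    proof -
      have "p j \<notin> p ` {..<j}" using lp by (simp add: legal_play_def)
      moreover have "p i \<in> p ` {..<j}" using that by simp
      ultimately show ?thesis by metis
    qed
    have inj: "inj p"
    proof (rule injI)
      fix i j assume "p i = p j"
      then show "i = j" using less[of i j] less[of j i] by (cases i j rule: linorder_cases) auto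
    qed
    have props: "finite (X k)" "finite (Y k)" "X k \<subseteq> board3" "Y k \<subseteq> board3" "X k \<inter> Y k = {}"
      "p (2 * k) \<in> board3" "p (2 * k) \<notin> X k \<union> Y k" for k
      using b by (auto simp: X_def Y_def dest: injD[OF inj])
    have "{i. i < 2 * Suc k \<and> even i} = insert (2 * k) {i. i < 2 * k \<and> even i}" for k
      by (auto elim!: evenE)
    then have XS: "X (Suc k) = insert (p (2 * k)) (X k)" for k
      by (simp add: X_def)
    have "{i. i < 2 * Suc k \<and> odd i} = insert (2 * k + 1) {i. i < 2 * k \<and> odd i}" for k
      by (auto elim!: oddE)
    then have YS: "Y (Suc k) = insert (p (2 * k + 1)) (Y k)" for k
      by (simp add: Y_def)
    have I: "I (X k) (Y k)" for k
    proof (induction k)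
      case 0
      then show ?case using init by (simp add: X_def Y_def)
    next
      case (Suc k)
      define h where "h = map p [0..<2 * k + 1]"
      have nth: "h ! i = p i" if "i < 2 * k + 1" for i
        unfolding h_def using that by (simp add: nth_map del: upt_Suc)
      have len: "length h = 2 * k + 1" by (simp add: h_def)
      have "xs h = p ` {i. i < 2 * k + 1 \<and> even i}"
        unfolding xs_def len using nth by (intro image_cong) auto
      moreover have "{i. i < 2 * k + 1 \<and> even i} = {i. i < 2 * Suc k \<and> even i}"
        by (rule Collect_cong) presburger
      ultimately have xs: "xs h = X (Suc k)" by (simp only: X_def)
      have "ys h = p ` {i. i < 2 * k + 1 \<and> odd i}"
        unfolding ys_def len using nth by (intro image_cong) auto
      moreover have "{i. i < 2 * k + 1 \<and> odd i} = {i. i < 2 * k \<and> odd i}"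
        by (rule Collect_cong) presburger
      ultimately have ys: "ys h = Y k" by (simp only: Y_def)
      have "set h = xs h \<union> ys h"
        unfolding xs_def ys_def set_conv_nth by auto
      then have set: "set h = X (Suc k) \<union> Y k" using xs ys by simp
      obtain e' where "e' \<in> board3" "e' \<notin> insert (p (2 * k)) (X k) \<union> Y k"
        "I (insert (p (2 * k)) (X k)) (insert e' (Y k))"
        using step[OF Suc props] by blast
      then have "good h e'" unfolding good_def set xs ys XS by blast
      then have "good h (\<sigma> h)" by (rule good)
      moreover have "p (2 * k + 1) = \<sigma> h" using fo by (simp add: follows_P2_def h_def)
      ultimately show ?case unfolding good_def xs ys YS by simp
    qed
    obtain n where n: "even n" "contains_copy G (P1_edges p n)"
      "\<And>m. m < n \<Longrightarrow> odd m \<Longrightarrow> \<not> contains_copy G (P2_edges p m)"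
      using win by (auto simp: P1_wins_def)
    obtain k where k: "n = 2 * k" using n(1) by auto
    have "{i. i \<le> 2 * k \<and> even i} = {i. i < 2 * Suc k \<and> even i}"
      by (rule Collect_cong) presburger
    then have "P1_edges p n = X (Suc k)"
      unfolding P1_edges_def X_def k by (simp only: setcompr_eq_image)
    \<comment> \<open>By \<open>step\<close>, the second player already has a copy among his first
      \<open>k\<close> edges, hence by move \<open>2 * k - 1\<close>; for \<open>k = 0\<close> it
      would have to be a copy without edges.\<close>
    then have cc: "contains_copy G (Y k)"
      using step[OF I props, of k] n(2) XS by auto
    show False
    proof (cases k)
      case 0
      then show False using cc nonempty by (auto simp: Y_def contains_copy_def)
    next
      case (Suc k')
      have "{i. i \<le> 2 * k' + 1 \<and> odd i} = {i. i < 2 * Suc k' \<and> odd i}"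
        by (rule Collect_cong) presburger
      then have "P2_edges p (2 * k' + 1) = Y k"
        unfolding P2_edges_def Y_def Suc by (simp only: setcompr_eq_image)
      then show False using n(3)[of "2 * k' + 1"] cc Suc k by simp
    qed
  qed
  moreover have "legal_P2_strategy \<sigma>" using legal by (simp add: legal_P2_strategy_def)
  ultimately show ?thesis by blast
qed

section \<open>Positions without a copy for the first player\<close>

definition has_copy :: "nat \<Rightarrow> nat set set \<Rightarrow> bool" where
  "has_copy t X \<longleftrightarrow> (\<exists>z x y M L. copy_shape (t + 1) (t - 2) z x y M L \<and> copy_edges z x y M L \<subseteq> X)"

text \<open>
  The parameter of type \<open>(nat \<times> nat \<times> nat) option\<close> records whether the opponent's first \<open>2 * t\<close> edges extend
  to a copy by \<open>t\<close> further edges; if so, it holds the centre and the two hubs of that copy.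
\<close>
fun guard :: "(nat \<times> nat \<times> nat) option \<Rightarrow> nat set set" where
  "guard None = {}"
| "guard (Some (c, a, d)) = {{c, h, v} | h v. h \<in> {a, d} \<and> v \<notin> {a, d, c}}"

text \<open>These are the neighbours of \<open>a\<close> in the opponent's link of \<open>c\<close>
  that can still become, or already are, common neighbours of \<open>a\<close> and \<open>d\<close>:
  the second player has not taken the partner edge.\<close>

definition half :: "nat \<Rightarrow> nat \<Rightarrow> nat \<Rightarrow> nat set set \<Rightarrow> nat set set \<Rightarrow> nat set" where
  "half c a d X Y = {v. v \<notin> {a, d, c} \<and> {c, a, v} \<in> X \<and> {c, d, v} \<notin> Y}"

text \<open>A common neighbour of the two hubs is counted twice, so \<open>t + 1\<close> of them
  would need potential at least \<open>2 * t + 2\<close>.\<close>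

fun potential :: "(nat \<times> nat \<times> nat) option \<Rightarrow> nat set set \<Rightarrow> nat set set \<Rightarrow> nat" where
  "potential None X Y = 0"
| "potential (Some (c, a, d)) X Y = card (half c a d X Y) + card (half c d a X Y)"

text \<open>
  The choices of the second player at the end of the star phase: \<open>E\<close> are the opponent's \<open>2 * t\<close> edges, the
  star has kernel \<open>{p, q}\<close> and leaves \<open>W\<close>, and \<open>{p, b, w1}\<close> is the next edge to claim. As the kernel is symmetric,
  \<open>p\<close> may be chosen to be no hub of the opponent's copy, or, if there is none, to be the end that the opponent
  touched less. In the latter case \<open>w1\<close> is a leaf that the opponent has already joined to \<open>p\<close>, if possible:
  otherwise he could use \<open>p\<close> and \<open>b\<close> as centre and hub of a copy over the leaves that he blocks.
\<close>
definition frame :: "nat \<Rightarrow> (nat \<times> nat \<times> nat) option \<Rightarrow> nat set set \<Rightarrow> nat \<Rightarrow> nat \<Rightarrow> nat \<Rightarrow> nat set \<Rightarrow> nat \<Rightarrow> bool"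
  where "frame t r E p q b W w1 \<longleftrightarrow> p \<noteq> q \<and> p \<notin> W \<and> q \<notin> W \<and> finite W \<and> card W = 2 * t - 1 \<and> w1 \<in> W \<and>
    b \<notin> {p, q} \<union> W \<union> \<Union> E \<and> finite E \<and> E \<subseteq> board3 \<and>
    (case r of
       None \<Rightarrow> card E = 2 * t \<and> (\<forall>F. finite F \<and> card F \<le> t \<longrightarrow> \<not> has_copy t (E \<union> F)) \<and>
         (\<exists>e\<in>E. p \<notin> e \<and> q \<notin> e) \<and> (\<forall>w\<in>W. {p, q, w} \<notin> E) \<and>
         card {e \<in> E. p \<in> e} \<le> card {e \<in> E. q \<in> e} \<and>
         ((\<exists>w\<in>W. \<exists>e\<in>E. p \<in> e \<and> w \<in> e) \<longrightarrow> (\<exists>e\<in>E. p \<in> e \<and> w1 \<in> e))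
     | Some (c, a, d) \<Rightarrow> c \<noteq> a \<and> c \<noteq> d \<and> a \<noteq> d \<and> p \<notin> {a, d, c} \<and> b \<notin> {a, d, c} \<and> E \<subseteq> guard r)"

section \<open>Guard edges and counts of triples\<close>

lemma guard_elim:
  assumes "e \<in> guard (Some (c, a, d))"
  obtains h v where "e = {c, h, v}" "h \<in> {a, d}" "v \<notin> {a, d, c}"
  using assms by auto

lemma guard_Some_mem:
  assumes "e \<in> guard (Some (c, a, d))"
  shows "c \<in> e" and "a \<in> e \<or> d \<in> e"
  using assms by auto

lemma guard_Some_not_both:
  assumes "e \<in> guard (Some (c, a, d))" "c \<noteq> a" "c \<noteq> d" "a \<noteq> d"
  shows "\<not> (a \<in> e \<and> d \<in> e)"
  using assms by auto

lemma guard_Some_third: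
  assumes "e \<in> guard (Some (c, a, d))" "z \<in> e" "z \<notin> {a, d, c}"
  shows "e \<in> {{c, a, z}, {c, d, z}}"
  using assms by auto

declare guard.simps(2) [simp del]

lemma triple_in_image:
  assumes "z \<notin> insert m S" "x \<notin> insert m S"
  shows "{z, x, m} \<in> (\<lambda>s. {z, x, s}) ` S \<longleftrightarrow> m \<in> S"
proof
  assume "{z, x, m} \<in> (\<lambda>s. {z, x, s}) ` S"
  then obtain s where "s \<in> S" "{z, x, m} = {z, x, s}" by blast
  moreover then have "m \<in> {z, x, s}" by blast
  ultimately show "m \<in> S" using assms by auto
qed blast

lemma triples_card_le:
  assumes "z \<notin> M" "x \<notin> M" "finite F" "\<And>m. m \<in> M \<Longrightarrow> {z, x, m} \<in> F"
  shows "card M \<le> card F"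
proof -
  have "card M = card ((\<lambda>m. {z, x, m}) ` M)" using assms by (simp add: card_triples)
  also have "\<dots> \<le> card F" using assms by (intro card_mono) auto
  finally show ?thesis .
qed

lemma two_triples_card_le:
  assumes "z \<notin> M" "x \<notin> M" "y \<notin> M" "x \<noteq> y" "z \<noteq> x" "finite M" "finite F"
    and "\<And>m. m \<in> M \<Longrightarrow> {z, x, m} \<in> F" "\<And>m. m \<in> M \<Longrightarrow> {z, y, m} \<in> F"
  shows "2 * card M \<le> card F"
proof -
  have ne: "{z, x, m} \<noteq> {z, y, m'}" if "m' \<in> M" for m m'
  proof -
    have "x \<notin> {z, y, m'}" using assms that by auto
    then show ?thesis by blast
  qed
  then have "(\<lambda>m. {z, x, m}) ` M \<inter> (\<lambda>m. {z, y, m}) ` M = {}" by blast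
  then have "card ((\<lambda>m. {z, x, m}) ` M \<union> (\<lambda>m. {z, y, m}) ` M) = card M + card M"
    using assms by (subst card_Un_disjoint) (auto simp: card_triples)
  moreover have "card ((\<lambda>m. {z, x, m}) ` M \<union> (\<lambda>m. {z, y, m}) ` M) \<le> card F"
    using assms by (intro card_mono) auto
  ultimately show ?thesis by simp
qed

text \<open>Guard edges contain \<open>c\<close> and exactly one of \<open>a\<close>,
  \<open>d\<close>. Any choice of centre and hubs other than \<open>c\<close> and
  \<open>{a, d}\<close> therefore needs more than \<open>t\<close> edges outside the guard, which
  \<open>F\<close> cannot supply, and the remaining choice needs \<open>t + 1\<close> common
  neighbours of \<open>a\<close> and \<open>d\<close> in the link of \<open>c\<close>.\<close>

lemma no_cone_near_guard:
  assumes t: "t \<ge> 3" and d: "c \<noteq> a" "c \<noteq> d" "a \<noteq> d"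
    and sh: "z \<noteq> x" "z \<noteq> y" "x \<noteq> y" "z \<notin> M" "x \<notin> M" "y \<notin> M" "finite M" "card M = t + 1"
    and ed: "\<And>m. m \<in> M \<Longrightarrow> {z, x, m} \<in> X" "\<And>m. m \<in> M \<Longrightarrow> {z, y, m} \<in> X"
    and sub: "\<And>e. e \<in> X \<Longrightarrow> z \<in> e \<Longrightarrow> e \<in> guard (Some (c, a, d)) \<union> F"
    and F: "finite F" "card F \<le> t"
    and common: "finite {v. v \<notin> {a, d, c} \<and> {c, a, v} \<in> X \<and> {c, d, v} \<in> X}"
      "card {v. v \<notin> {a, d, c} \<and> {c, a, v} \<in> X \<and> {c, d, v} \<in> X} \<le> t"
  shows False
proof (cases "z = c")
  case False
  have inF: "{z, h, m} \<in> F" if "{z, h, m} \<in> X" "h \<noteq> c" "m \<noteq> c" for h m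
    using sub[OF that(1)] that(2,3) False guard_Some_mem(1)[of "{z, h, m}" c a d] by blast
  consider "x = c" | "y = c" | "x \<noteq> c" "y \<noteq> c" by blast
  then show False
  proof cases
    case 1
    have "card M \<le> card F"
      by (rule triples_card_le[of z M y]) (use sh F inF ed 1 in auto)
    then show False using sh F by simp
  next
    case 2
    have "card M \<le> card F"
      by (rule triples_card_le[of z M x]) (use sh F inF ed 2 in auto)
    then show False using sh F by simp
  next
    case 3
    have "2 * card (M - {c}) \<le> card F"
      by (rule two_triples_card_le[of z _ x y]) (use sh F inF ed 3 in auto)
    moreover have "card (M - {c}) \<ge> t" using sh by (simp add: card_Diff_singleton_if)
    ultimately show False using F t by simp
  qed
next
  case True
  have inF: "{c, h, m} \<in> F" if "{c, h, m} \<in> X" "h \<notin> {a, d}" "m \<notin> {a, d}" for h m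
    using sub[OF that(1)] that(2,3) True d guard_Some_mem(2)[of "{c, h, m}" c a d] by blast
  have adF: "{c, a, d} \<in> F" if "{c, a, d} \<in> X"
    using sub[OF that] True guard_Some_not_both[OF _ d, of "{c, a, d}"] by blast
  have one: False if h: "h \<in> {a, d}" "k \<notin> {a, d}" "k \<noteq> c" "h \<notin> M" "k \<notin> M"
    "\<And>m. m \<in> M \<Longrightarrow> {c, h, m} \<in> X" "\<And>m. m \<in> M \<Longrightarrow> {c, k, m} \<in> X" for h k
  proof (cases "M \<inter> {a, d} = {}")
    case True
    have "card M \<le> card F"
      by (rule triples_card_le[of c M k]) (use sh F inF h True \<open>z = c\<close> in auto)
    then show False using sh F by simp
  next
    case False
    then obtain h' where h': "h' \<in> M" "h' \<in> {a, d}" "h' \<noteq> h" "{h, h'} = {a, d}" using h by auto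
    \<comment> \<open>One middle vertex is the other hub of the guard. Its edge to \<open>k\<close>
      may be a guard edge, but its edge to \<open>h\<close> is \<open>{c, a, d}\<close>, which meets
      both hubs and so lies in \<open>F\<close>. This makes up for the loss.\<close>
    have "{c, a, d} = {c, h, h'}" using h' by blast
    then have "{c, a, d} \<in> F" using adF h(6) h'(1) by auto
    have "card (M - {h'}) \<le> card (F - {{c, a, d}})"
    proof (rule triples_card_le[of c _ k])
      show "{c, k, m} \<in> F - {{c, a, d}}" if "m \<in> M - {h'}" for m
      proof -
        have "k \<notin> {c, a, d}" using h by auto
        then have "{c, k, m} \<noteq> {c, a, d}" by blast
        moreover have "m \<notin> {a, d}" using that h' h(4) by auto
        ultimately show ?thesis using inF[of k m] h(2,7) that by auto
      qed
    qed (use sh F h \<open>z = c\<close> in auto)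
    moreover have "card (F - {{c, a, d}}) < card F"
      using F \<open>{c, a, d} \<in> F\<close> by (meson card_Diff1_less)
    moreover have "card (M - {h'}) = t" using h' sh by simp
    ultimately show False using F by simp
  qed
  consider "{x, y} = {a, d}" | "x \<in> {a, d}" "y \<notin> {a, d}" | "y \<in> {a, d}" "x \<notin> {a, d}"
    | "x \<notin> {a, d}" "y \<notin> {a, d}" using sh(3) by auto
  then show False
  proof cases
    case 1
    then have xy: "x = a \<and> y = d \<or> x = d \<and> y = a" by (simp add: doubleton_eq_iff)
    have "M \<subseteq> {v. v \<notin> {a, d, c} \<and> {c, a, v} \<in> X \<and> {c, d, v} \<in> X}"
    proof
      fix m assume m: "m \<in> M"
      have "{c, a, m} \<in> X" "{c, d, m} \<in> X" using ed[OF m] xy True by auto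
      moreover have "m \<notin> {a, d, c}" using xy m sh(4-6) True by auto
      ultimately show "m \<in> {v. v \<notin> {a, d, c} \<and> {c, a, v} \<in> X \<and> {c, d, v} \<in> X}" by blast
    qed
    then have "card M \<le> t" using common card_mono le_trans by blast
    then show False using sh by simp
  next
    case 2 then show False using one[of x y] sh ed True by auto
  next
    case 3 then show False using one[of y x] sh ed True by auto
  next
    case 4
    \<comment> \<open>At least \<open>t - 1\<close> middle vertices avoid \<open>a\<close> and
      \<open>d\<close>, and \<open>2 * (t - 1) > t\<close> because \<open>t \<ge> 3\<close>.\<close>
    have "2 * card (M - {a, d}) \<le> card F"
      by (rule two_triples_card_le[of c _ x y]) (use sh F inF ed 4 True in auto)
    moreover have "card (M - {a, d}) \<ge> card M - card {a, d}"
      by (rule diff_card_le_card_Diff) simp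
    ultimately show False using F t sh d by auto
  qed
qed

lemma finite_half:
  assumes "finite X" "X \<subseteq> board3"
  shows "finite (half c a d X Y)"
proof (rule finite_subset)
  show "half c a d X Y \<subseteq> \<Union> X" by (auto simp: half_def)
  have "finite e" if "e \<in> X" for e
  proof (rule card_ge_0_finite)
    show "card e > 0" using assms that by (auto simp: board3_def)
  qed
  then show "finite (\<Union> X)" using assms by auto
qed

text \<open>Since \<open>X\<close> and \<open>Y\<close> are disjoint, a common neighbour belongs to
  both halves; twice their number is at most \<open>2 * t + 1\<close>.\<close>

lemma common_le_potential:
  assumes "finite X" "X \<subseteq> board3" "X \<inter> Y = {}" "potential (Some (c, a, d)) X Y \<le> 2 * t + 1"
  shows "finite {v. v \<notin> {a, d, c} \<and> {c, a, v} \<in> X \<and> {c, d, v} \<in> X}" (is "finite ?C")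
    and "card {v. v \<notin> {a, d, c} \<and> {c, a, v} \<in> X \<and> {c, d, v} \<in> X} \<le> t"
proof -
  have s: "?C \<subseteq> half c a d X Y" "?C \<subseteq> half c d a X Y"
    using assms by (auto simp: half_def)
  note f = finite_half[OF assms(1,2)]
  show "finite ?C" using s f finite_subset by blast
  have "card ?C \<le> card (half c a d X Y)" "card ?C \<le> card (half c d a X Y)"
    using s f card_mono by blast+
  then show "card ?C \<le> t" using assms(4) by simp
qed

text \<open>\<open>F\<close> holds the opponent's moves outside \<open>E\<close> and the guard. With
  no recorded copy the frame itself forbids completion by \<open>t\<close> edges; with a recorded
  one the potential limits the common neighbours of its hubs.\<close>

lemma no_copy_building:
  assumes "t \<ge> 3" "frame t r E p q b W w1" "X \<subseteq> E \<union> guard r \<union> F" "finite F" "card F \<le> t"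
    "potential r X Y \<le> 2 * t + 1" "X \<inter> Y = {}" "finite X" "X \<subseteq> board3"
  shows "\<not> has_copy t X"
proof (cases r)
  case None
  then have "\<not> has_copy t (E \<union> F)" using assms by (simp add: frame_def)
  moreover have "X \<subseteq> E \<union> F" using assms None by simp
  ultimately show ?thesis unfolding has_copy_def by blast
next
  case (Some r')
  obtain c a d where r: "r = Some (c, a, d)" using Some by (cases r') auto
  have fr: "c \<noteq> a" "c \<noteq> d" "a \<noteq> d" "E \<subseteq> guard r" using assms(2) r by (auto simp: frame_def)
  show ?thesis
  proof
    assume "has_copy t X"
    then obtain z x y M L where S: "copy_shape (t + 1) (t - 2) z x y M L" and C: "copy_edges z x y M L \<subseteq> X"
      by (auto simp: has_copy_def)
    show False
      by (rule no_cone_near_guard[of t c a d z x y M X F])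
        (use assms fr r S C common_le_potential[of X Y c a d t] in \<open>auto simp: copy_shape_def copy_edges_def\<close>)
  qed
qed

text \<open>Here \<open>{z, k}\<close> is the pair \<open>{p, b}\<close> in the presence of a guard.
  Besides edges through \<open>k\<close>, at most four edges at \<open>z\<close> are available, too
  few for two hubs other than \<open>k\<close>. If \<open>k\<close> is a hub, the other hub
  \<open>x\<close> uses up \<open>f\<close> and \<open>g\<close>, and \<open>k\<close> is left with
  the \<open>t - 1\<close> vertices of \<open>S\<close>, since a fresh vertex of \<open>V\<close>
  can be joined to \<open>x\<close> only by \<open>g\<close>.\<close>

lemma no_cone_at_kernel:
  assumes t: "t \<ge> 3"
    and sh: "z \<noteq> x" "z \<noteq> y" "x \<noteq> y" "z \<notin> M" "x \<notin> M" "y \<notin> M" "finite M" "card M = t + 1"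
    and ed: "\<And>m. m \<in> M \<Longrightarrow> {z, x, m} \<in> X" "\<And>m. m \<in> M \<Longrightarrow> {z, y, m} \<in> X"
    and k: "k \<noteq> z" "k \<noteq> x" "z \<notin> {a, d, c}" "k \<notin> {a, d, c}"
    and S: "finite S" "card S = t - 1" and V: "V \<inter> \<Union> X1 = {}" and zk: "k \<notin> S \<union> V" "z \<notin> S \<union> V"
    and X1: "X1 \<subseteq> guard (Some (c, a, d)) \<union> (\<lambda>s. {z, k, s}) ` S \<union> {f}"
    and X: "X \<subseteq> X1 \<union> (\<lambda>v. {z, k, v}) ` V \<union> {g}"
  shows False
proof -
  \<comment> \<open>The last two are the only guard edges that can contain \<open>z\<close>, which
    is none of \<open>c\<close>, \<open>a\<close>, \<open>d\<close>.\<close>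
  define Q where "Q = {f, g, {c, a, z}, {c, d, z}}"
  have Q: "finite Q" "card Q \<le> 4" unfolding Q_def
    using card_insert_le_m1[of 4 "{g, {c, a, z}, {c, d, z}}" f] card_insert_le_m1[of 3 "{{c, a, z}, {c, d, z}}" g]
      card_insert_le_m1[of 2 "{{c, d, z}}" "{c, a, z}"] by auto
  have inX1: "e \<in> X1 \<or> e = g" if "e \<in> X" "k \<notin> e" for e
    using X that by blast
  have inQ: "e \<in> Q" if "e \<in> X" "z \<in> e" "k \<notin> e" for e
    using inX1[OF that(1,3)] X1 that guard_Some_third[of e c a d z] k(3) unfolding Q_def by blast
  show False
  proof (cases "y = k")
    case False
    have "2 * card (M - {k}) \<le> card Q"
      by (rule two_triples_card_le[of z _ x y]) (use sh Q inQ ed k False in auto)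
    moreover have "card (M - {k}) \<ge> t" using sh by (simp add: card_Diff_singleton_if)
    ultimately show False using Q t by simp
  next
    case True
    have kM: "k \<notin> M" using True sh by simp
    have kx: "k \<notin> {z, x, m}" if "m \<in> M" for m using k kM that by auto
    have sub: "(\<lambda>m. {z, x, m}) ` M \<subseteq> Q" using inQ ed(1) kx by blast
    have "card ((\<lambda>m. {z, x, m}) ` M) = t + 1" using sh by (simp add: card_triples)
    \<comment> \<open>At least four edges inside a set of at most four: every element of
      \<open>Q\<close> is an edge at \<open>x\<close>, in particular \<open>f\<close> and
      \<open>g\<close>.\<close>
    then have im: "(\<lambda>m. {z, x, m}) ` M = Q" using sub Q t by (intro card_seteq) auto
    have "f \<in> Q" "g \<in> Q" by (auto simp: Q_def)
    then have "f \<in> (\<lambda>m. {z, x, m}) ` M" "g \<in> (\<lambda>m. {z, x, m}) ` M" using im by simp_all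
    then obtain mg where mg: "mg \<in> M" "g = {z, x, mg}" and fk: "k \<notin> f" using kx by blast
    have gk: "k \<notin> g" using kx mg by blast
    have "M - {mg} \<subseteq> S"
    proof
      fix m assume m: "m \<in> M - {mg}"
      then have "m \<notin> {z, x, mg}" using sh by auto
      then have "{z, x, m} \<noteq> g" using mg by blast
      then have "{z, x, m} \<in> X1" using inX1[OF ed(1)] kx m by blast
      then have mV: "m \<notin> V" using V by blast
      have mzk: "m \<noteq> z" "m \<noteq> k" using m sh kM by auto
      have zkm: "{z, k, m} \<in> (\<lambda>s. {z, k, s}) ` N \<longleftrightarrow> m \<in> N" if "N \<subseteq> S \<union> V" for N
        by (rule triple_in_image) (use mzk zk that in auto)
      have e: "{z, k, m} \<in> X" using ed(2) m True by blast
      have "{z, k, m} \<noteq> g" "{z, k, m} \<noteq> f" using fk gk by blast+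
      moreover have "{z, k, m} \<notin> (\<lambda>v. {z, k, v}) ` V" using zkm[of V] mV by blast
      moreover have "{z, k, m} \<notin> guard (Some (c, a, d))"
      proof
        assume g: "{z, k, m} \<in> guard (Some (c, a, d))"
        then have "m = c" "m = a \<or> m = d" using guard_Some_mem[OF g] k by auto
        moreover obtain h v where "{z, k, m} = {c, h, v}" "h \<in> {a, d}" "v \<notin> {a, d, c}"
          using g by (rule guard_elim)
        ultimately show False using k
          by (metis insert_iff singletonD)
      qed
      ultimately have "{z, k, m} \<in> (\<lambda>s. {z, k, s}) ` S" using e X X1 by blast
      then show "m \<in> S" using zkm[of S] by blast
    qed
    then have "card (M - {mg}) \<le> card S" using S card_mono by blast
    then show False using mg sh S t by simp
  qed
qed

text \<open>With \<open>b\<close> as a hub, all of \<open>S\<close> and both spare edges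
  \<open>f\<close>, \<open>g\<close> are needed to reach \<open>t + 1\<close> middle vertices, so
  \<open>t\<close> of the edges at \<open>x\<close> come from \<open>E\<close> and contain
  \<open>p\<close>. The choice of \<open>w1\<close> yields a further constraint on \<open>E\<close>,
  and together they force \<open>p\<close> to have larger degree in \<open>E\<close> than
  \<open>q\<close>, against the choice of \<open>p\<close>.\<close>

lemma no_hub_pair_at_kernel:
  assumes t: "t \<ge> 3" and frame: "frame t None E p q b W w1"
    and sh: "p \<noteq> x" "x \<noteq> b" "p \<notin> M" "x \<notin> M" "b \<notin> M" "finite M" "card M = t + 1"
    and ed: "\<And>m. m \<in> M \<Longrightarrow> {p, x, m} \<in> X" "\<And>m. m \<in> M \<Longrightarrow> {p, b, m} \<in> X"
    and S: "S \<subseteq> W" "card S = t - 1" "w1 \<notin> S"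
    and V: "V \<inter> \<Union> X1 = {}" "p \<notin> V" "b \<notin> V"
    and X1: "X1 \<subseteq> E \<union> (\<lambda>s. {p, b, s}) ` S \<union> {f}"
    and X: "X \<subseteq> X1 \<union> (\<lambda>v. {p, b, v}) ` V \<union> {g}"
    and w1: "{p, b, w1} \<notin> X"
  shows False
proof -
  have fr: "p \<noteq> q" "p \<notin> W" "q \<notin> W" "finite W" "w1 \<in> W" "b \<noteq> p" "b \<noteq> q" "b \<notin> W" "b \<notin> \<Union> E" "finite E"
    "card E = 2 * t" "\<exists>e\<in>E. p \<notin> e \<and> q \<notin> e" "\<And>w. w \<in> W \<Longrightarrow> {p, q, w} \<notin> E"
    "card {e \<in> E. p \<in> e} \<le> card {e \<in> E. q \<in> e}"
    "(\<exists>w\<in>W. \<exists>e\<in>E. p \<in> e \<and> w \<in> e) \<longrightarrow> (\<exists>e\<in>E. p \<in> e \<and> w1 \<in> e)"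
    using frame by (auto simp: frame_def)
  have finS: "finite S" using finite_subset[OF S(1) fr(4)] .
  have bE: "b \<notin> e" if "e \<in> E" for e using fr(9) that by blast
  have inj: "{p, b, m} = {p, b, s} \<Longrightarrow> s = m" if "m \<in> M" "s \<in> M" for m s
    using triple_in_image[of p s "{m}" b] that sh by (metis image_insert image_empty insert_iff singletonD)
  have inj': "{p, x, m} = {p, x, s} \<Longrightarrow> s = m" if "m \<in> M" "s \<in> M" for m s
    using triple_in_image[of p s "{m}" x] that sh by (metis image_insert image_empty insert_iff singletonD)
  have inK: "{p, b, m} \<in> (\<lambda>s. {p, b, s}) ` N \<longleftrightarrow> m \<in> N" if "m \<in> M" "N \<subseteq> S \<union> V" for N m
    by (rule triple_in_image) (use that S(1) fr(2,8) V(2,3) sh(3,5) in auto)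
  have bx: "b \<notin> {p, x, m}" if "m \<in> M" for m using that sh fr(6) by auto
  have xX1: "{p, x, m} \<in> X1 \<or> {p, x, m} = g" if "m \<in> M" for m
    using ed(1)[OF that] X bx[OF that] by blast
  have xE: "{p, x, m} \<in> E" if "m \<in> M" "{p, x, m} \<noteq> g" "b \<in> f" for m
    using xX1[OF that(1)] that X1 bx[OF that(1)] by blast
  \<comment> \<open>A middle vertex outside \<open>S\<close> must use \<open>f\<close> as its edge
    to \<open>b\<close> or use \<open>g\<close> as one of its two edges; each of \<open>f\<close>,
    \<open>g\<close> can serve only one vertex.\<close>
  define A where "A = {m \<in> M. {p, b, m} = f}"
  define B where "B = {m \<in> M. {p, b, m} = g \<or> {p, x, m} = g}"
  have "M - S \<subseteq> A \<union> B"
  proof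
    fix m assume m: "m \<in> M - S"
    then have mM: "m \<in> M" by blast
    have "{p, b, m} \<notin> (\<lambda>s. {p, b, s}) ` S"
      using inK[OF mM, of S] m by blast
    moreover have "{p, b, m} \<notin> E" using bE by blast
    ultimately have "{p, b, m} = f" if "{p, b, m} \<in> X1" using that X1 by blast
    moreover have "{p, x, m} = g" if "{p, b, m} \<in> (\<lambda>v. {p, b, v}) ` V"
    proof -
      have "m \<in> V" using that inK[OF mM, of V] by blast
      then have "{p, x, m} \<notin> X1" using V(1) by blast
      then show ?thesis using xX1[OF mM] by blast
    qed
    ultimately show "m \<in> A \<union> B" using ed(2)[OF mM] X mM unfolding A_def B_def by blast
  qed
  have finAB: "finite A" "finite B" using sh(6) by (auto simp: A_def B_def)
  have "m = m'" if "m \<in> A" "m' \<in> A" for m m'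
    using that inj[of m m'] by (auto simp: A_def)
  then have cA: "card A \<le> 1" using card_le_Suc0_iff_eq[OF finAB(1)] by simp
  have "m = m'" if "m \<in> B" "m' \<in> B" for m m'
  proof -
    have mm: "m \<in> M" "m' \<in> M" using that by (auto simp: B_def)
    have "{p, b, m} \<noteq> {p, x, m'}" "{p, b, m'} \<noteq> {p, x, m}" using bx[OF mm(1)] bx[OF mm(2)] by blast+
    moreover have "{p, b, m} = g \<or> {p, x, m} = g" "{p, b, m'} = g \<or> {p, x, m'} = g"
      using that unfolding B_def by blast+
    ultimately show ?thesis using inj[OF mm] inj'[OF mm] by metis
  qed
  then have cB: "card B \<le> 1" using card_le_Suc0_iff_eq[OF finAB(2)] by simp
  have "M \<subseteq> (M \<inter> S) \<union> (A \<union> B)" using \<open>M - S \<subseteq> A \<union> B\<close> by blast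
  then have "card M \<le> card ((M \<inter> S) \<union> (A \<union> B))" using sh(6) finAB by (intro card_mono) auto
  also have "\<dots> \<le> card (M \<inter> S) + (card A + card B)"
    by (meson card_Un_le le_trans add_left_mono)
  finally have le: "t + 1 \<le> card (M \<inter> S) + (card A + card B)" using sh by simp
  have "card (M \<inter> S) \<le> card S" using finS by (intro card_mono) auto
  \<comment> \<open>The bound \<open>t + 1 \<le> (t - 1) + 1 + 1\<close> is tight in every
    summand.\<close>
  then have cMS: "card (M \<inter> S) = card S" and "card A = 1" "card B = 1" using le cA cB S t by linarith+
  then have SM: "S \<subseteq> M" using finS by (metis card_subset_eq inf.cobounded2 inf.absorb_iff2)
  obtain u where Au: "A = {u}"
    using \<open>card A = 1\<close> by (auto simp: card_1_singleton_iff)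
  then have u: "u \<in> M" "{p, b, u} = f" unfolding A_def by blast+
  obtain u' where Bu': "B = {u'}"
    using \<open>card B = 1\<close> by (auto simp: card_1_singleton_iff)
  have "card (M - S) = 2" using cMS S sh t SM finS by (simp add: card_Diff_subset)
  moreover have "M - S \<subseteq> {u, u'}" using \<open>M - S \<subseteq> A \<union> B\<close> Au Bu' by blast
  ultimately have MS: "M - S = {u, u'}" and "u \<noteq> u'"
    using card_mono[of "{u, u'}" "M - S"] card_seteq[of "{u, u'}" "M - S"] by (cases "u = u'"; auto)+
  \<comment> \<open>Over \<open>T\<close> the edges to \<open>x\<close> are neither
    \<open>g\<close>, which is spent on \<open>u'\<close>, nor \<open>f\<close>, which contains
    \<open>b\<close>; so they belong to \<open>E\<close>.\<close>
  define T where "T = insert u S"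
  have TM: "T \<subseteq> M" using SM u by (simp add: T_def)
  have uS: "u \<notin> S" using MS by blast
  have u'T: "u' \<notin> T" using MS \<open>u \<noteq> u'\<close> by (auto simp: T_def)
  have cT: "card T = t" unfolding T_def using uS finS S t by simp
  have finT: "finite T" using finS by (simp add: T_def)
  have TE: "{p, x, m} \<in> E" if "m \<in> T" for m
  proof (rule xE)
    show "m \<in> M" using that TM by blast
    show "b \<in> f" using u by blast
    have "m \<notin> B" using that u'T Bu' by blast
    then show "{p, x, m} \<noteq> g" using \<open>m \<in> M\<close> by (auto simp: B_def)
  qed
  have "u \<noteq> w1" using u ed(2) w1 by blast
  then have w1T: "w1 \<notin> T" using S by (simp add: T_def)
  have "S \<noteq> {}" using S t by auto
  then obtain s0 where s0: "s0 \<in> S" "s0 \<in> W" "s0 \<in> T" using S by (auto simp: T_def)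
  have xq: "x \<noteq> q" using TE[OF s0(3)] fr(13)[OF s0(2)] by metis
  \<comment> \<open>The leaf \<open>s0\<close> is joined to \<open>p\<close> in \<open>E\<close>, so
    by the choice of \<open>w1\<close> in the frame \<open>w1\<close> is too.\<close>
  obtain e where e: "e \<in> E" "p \<in> e" "w1 \<in> e"
    using fr(15) s0(2) TE[OF s0(3)] by blast
  obtain e1 where e1: "e1 \<in> E" "p \<notin> e1" "q \<notin> e1" using fr(12) by blast
  define R where "R = (\<lambda>m. {p, x, m}) ` T"
  have cR: "card R = t" unfolding R_def using card_triples[of p T x] TM sh cT by auto
  have finR: "finite R" using finT by (simp add: R_def)
  have RE: "R \<subseteq> E" using TE by (auto simp: R_def)
  have pR: "\<And>r. r \<in> R \<Longrightarrow> p \<in> r" by (auto simp: R_def)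
  have dq: "card {e \<in> E. q \<in> e} \<le> 2 * t - card Z" if Z: "Z \<subseteq> E" "\<And>z. z \<in> Z \<Longrightarrow> q \<notin> z" for Z
  proof -
    have "{e \<in> E. q \<in> e} \<subseteq> E - Z" using Z by blast
    then have "card {e \<in> E. q \<in> e} \<le> card (E - Z)" using fr(10) by (intro card_mono) auto
    also have "\<dots> = card E - card Z" using Z fr(10) finite_subset by (intro card_Diff_subset) auto
    finally show ?thesis using fr(11) by simp
  qed
  have dp: "card {e \<in> E. p \<in> e} \<ge> card Z" if Z: "Z \<subseteq> E" "\<And>z. z \<in> Z \<Longrightarrow> p \<in> z" for Z
    using Z fr(10) by (intro card_mono) auto
  show False
  proof (cases "x = w1")
    \<comment> \<open>All \<open>t\<close> edges of \<open>R\<close> avoid \<open>q\<close>, as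
      \<open>{p, q, w1}\<close> is not in \<open>E\<close>. Together with \<open>e1\<close> this
      leaves at most \<open>t - 1\<close> edges at \<open>q\<close>.\<close>
    case True
    have "q \<notin> r" if r: "r \<in> R" for r
    proof
      assume "q \<in> r"
      obtain m where m: "m \<in> T" "r = {p, x, m}" using r by (auto simp: R_def)
      then have "m = q" using \<open>q \<in> r\<close> fr(1) xq by auto
      then have "r = {p, q, w1}" using m True by blast
      then show False using r RE fr(13)[OF fr(5)] by blast
    qed
    then have "card {e \<in> E. q \<in> e} \<le> 2 * t - card (insert e1 R)"
      using e1 RE by (intro dq) auto
    moreover have "card (insert e1 R) = t + 1" using e1 pR finR cR by (subst card_insert_disjoint) auto
    moreover have "card {e \<in> E. p \<in> e} \<ge> card R" using RE pR by (intro dp) auto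
    ultimately show False using fr(14) cR t by simp
  next
    case False
    have eR: "e \<notin> R"
    proof
      assume "e \<in> R"
      then obtain m where "m \<in> T" "e = {p, x, m}" by (auto simp: R_def)
      then show False using e False w1T fr(2,5) by auto
    qed
    have qe: "q \<notin> e"
    proof
      assume "q \<in> e"
      then have "{p, q, w1} \<subseteq> e" using e by auto
      moreover have "card e = 3" using e frame by (auto simp: frame_def board3_def)
      moreover have "p \<noteq> w1" "q \<noteq> w1" using fr(2,3,5) by blast+
      then have "card {p, q, w1} = 3" using fr(1) by simp
      ultimately have "{p, q, w1} = e" by (metis card_subset_eq card.infinite zero_neq_numeral)
      then show False using e(1) fr(13)[OF fr(5)] by blast
    qed
    \<comment> \<open>At most one edge of \<open>R\<close> passes through \<open>q\<close>. The
      others, \<open>e\<close> and \<open>e1\<close> are at least \<open>t + 1\<close> edges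
      avoiding \<open>q\<close>, while \<open>R\<close> and \<open>e\<close> give \<open>p\<close>
      degree at least \<open>t + 1\<close>.\<close>
    define R' where "R' = (\<lambda>m. {p, x, m}) ` (T - {q})"
    have R'R: "R' \<subseteq> R" by (auto simp: R'_def R_def)
    have cR': "card R' \<ge> t - 1"
    proof -
      have "card R' = card (T - {q})" unfolding R'_def using card_triples[of p "T - {q}" x] TM sh by auto
      then show ?thesis using cT finT by (simp add: card_Diff_singleton_if)
    qed
    have qR': "q \<notin> r" if "r \<in> R'" for r
      using that xq fr(1) by (auto simp: R'_def)
    have "card {e \<in> E. q \<in> e} \<le> 2 * t - card (insert e1 (insert e R'))"
      using e1 e RE R'R qe qR' by (intro dq) auto
    moreover have "card (insert e1 (insert e R')) = Suc (Suc (card R'))"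
    proof -
      have "e1 \<notin> insert e R'" "e \<notin> R'" using e1 e pR R'R eR by blast+
      then show ?thesis using finR R'R finite_subset by (metis card_insert_disjoint finite_insert)
    qed
    moreover have "card {e \<in> E. p \<in> e} \<ge> card (insert e R)" using RE pR e by (intro dp) auto
    moreover have "card (insert e R) = Suc t" using eR finR cR by simp
    ultimately show False using fr(14) cR' t by simp
  qed
qed

lemma card_3_le: "card {u, v, w} \<le> 3"
  using card_length[of "[u, v, w]"] by simp

text \<open>The hubs must be leaves in \<open>S\<close>, since a vertex of \<open>V\<close> has only
  \<open>g\<close> besides its edge to \<open>b\<close>. All but two of the \<open>2 * t\<close>
  edges from the hubs to the other middle vertices then lie in \<open>E\<close>. They contain
  \<open>p\<close> and, as \<open>E\<close> misses the star, not \<open>q\<close>, so the degree of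
  \<open>p\<close> exceeds that of \<open>q\<close>.\<close>

lemma no_mid_at_kernel:
  assumes t: "t \<ge> 3" and frame: "frame t None E p q b W w1"
    and sh: "p \<noteq> x" "p \<noteq> y" "x \<noteq> y" "p \<notin> M" "x \<notin> M" "y \<notin> M" "finite M" "card M = t + 1" "b \<in> M"
    and ed: "\<And>m. m \<in> M \<Longrightarrow> {p, x, m} \<in> X" "\<And>m. m \<in> M \<Longrightarrow> {p, y, m} \<in> X"
    and S: "S \<subseteq> W" and xy: "x \<in> S \<union> V" "y \<in> S \<union> V"
    and V: "V \<inter> \<Union> X1 = {}"
    and X1: "X1 \<subseteq> E \<union> (\<lambda>s. {p, b, s}) ` S \<union> {f}"
    and X: "X \<subseteq> X1 \<union> (\<lambda>v. {p, b, v}) ` V \<union> {g}"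
  shows False
proof -
  have fr: "p \<noteq> q" "q \<notin> W" "finite E"
    "card E = 2 * t" "\<exists>e\<in>E. p \<notin> e \<and> q \<notin> e" "\<And>w. w \<in> W \<Longrightarrow> {p, q, w} \<notin> E"
    "card {e \<in> E. p \<in> e} \<le> card {e \<in> E. q \<in> e}"
    using frame by (auto simp: frame_def)
  have bp: "b \<noteq> p" "b \<noteq> x" "b \<noteq> y" using sh by auto
  define M' where "M' = M - {b}"
  have M': "finite M'" "card M' = t" "M' \<subseteq> M" "b \<notin> M'" using sh by (auto simp: M'_def)
  have X1g: "{p, h, m} \<in> X1 \<or> {p, h, m} = g" if "m \<in> M'" "h \<in> {x, y}" for h m
  proof -
    have "b \<notin> {p, h, m}" using that bp M' by auto
    moreover have "{p, h, m} \<in> X" using that ed M' by auto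
    ultimately show ?thesis using X by blast
  qed
  have inS: "h \<in> S" if h: "h \<in> {x, y}" for h
  proof (rule ccontr)
    assume "h \<notin> S"
    then have "h \<in> V" using h xy by blast
    then have "{p, h, m} = g" if "m \<in> M'" for m using X1g[OF that h] V by blast
    then have "card M' \<le> card {g}"
      using M' sh h by (intro triples_card_le[of p M' h]) auto
    then show False using M' t by simp
  qed
  define R where "R = (\<lambda>m. {p, x, m}) ` M' \<union> (\<lambda>m. {p, y, m}) ` M'"
  have finR: "finite R" using M' by (simp add: R_def)
  have cR: "2 * t \<le> card R"
    using two_triples_card_le[of p M' x y R] M' sh finR by (auto simp: R_def)
  have RX: "R \<subseteq> E \<union> {f, g}"
  proof
    fix r assume "r \<in> R"
    then obtain h m where r: "r = {p, h, m}" "h \<in> {x, y}" "m \<in> M'" by (auto simp: R_def)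
    then have "b \<notin> r" using bp M' by auto
    moreover have "r \<in> X1 \<or> r = g" using X1g r by blast
    ultimately show "r \<in> E \<union> {f, g}" using X1 by blast
  qed
  define Z where "Z = R \<inter> E"
  have "card R \<le> card (Z \<union> {f, g})" using RX fr(3) by (intro card_mono) (auto simp: Z_def)
  also have "\<dots> \<le> card Z + card {f, g}" by (rule card_Un_le)
  also have "\<dots> \<le> card Z + 2" by (simp add: card_insert_if)
  finally have cZ: "2 * t \<le> card Z + 2" using cR by simp
  have pZ: "p \<in> r" if "r \<in> Z" for r using that by (auto simp: Z_def R_def)
  have qZ: "q \<notin> r" if r: "r \<in> Z" for r
  proof
    assume q: "q \<in> r"
    obtain h m where h: "r = {p, h, m}" "h \<in> {x, y}" using r by (auto simp: Z_def R_def)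
    then have hW: "h \<in> W" using inS S by blast
    then have "h \<noteq> q" using fr by blast
    then have "r = {p, q, h}" using q h fr(1) by auto
    then show False using fr(6)[OF hW] r by (simp add: Z_def)
  qed
  obtain e1 where e1: "e1 \<in> E" "p \<notin> e1" "q \<notin> e1" using fr(5) by blast
  have "card {e \<in> E. q \<in> e} \<le> card (E - insert e1 Z)"
    using fr(3) qZ e1 by (intro card_mono) auto
  also have "\<dots> = card E - card (insert e1 Z)"
    using finR e1 by (intro card_Diff_subset) (auto simp: Z_def)
  also have "card (insert e1 Z) = Suc (card Z)"
    using finR e1 pZ by (subst card_insert_disjoint) (auto simp: Z_def)
  finally have "card {e \<in> E. q \<in> e} \<le> 2 * t - Suc (card Z)" using fr(4) by simp
  moreover have "card Z \<le> card {e \<in> E. p \<in> e}"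
    using fr(3) pZ by (intro card_mono) (auto simp: Z_def)
  ultimately show False using fr(7) cZ t by simp
qed

text \<open>
  \<open>X1\<close> is the opponent's position when the infinite sequence of threats starts, \<open>V\<close> the set of fresh vertices
  used so far, and \<open>g\<close> an arbitrary move made instead of answering the current threat.
\<close>
lemma no_copy_threats:
  assumes t: "t \<ge> 3" and frame: "frame t r E p q b W w1"
    and S: "S \<subseteq> W" "card S = t - 1" "w1 \<notin> S"
    and V: "V \<inter> \<Union> X1 = {}" "p \<notin> V" "b \<notin> V"
    and X1: "X1 \<subseteq> E \<union> guard r \<union> (\<lambda>s. {p, b, s}) ` S \<union> {f}"
    and X: "X \<subseteq> X1 \<union> (\<lambda>v. {p, b, v}) ` V \<union> {g}"
    and w1: "{p, b, w1} \<notin> X"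
    and pot: "potential r X Y \<le> 2 * t + 1" "X \<inter> Y = {}" "finite X" "X \<subseteq> board3"
  shows "\<not> has_copy t X"
proof
  assume "has_copy t X"
  then obtain z x y M L where Sh: "copy_shape (t + 1) (t - 2) z x y M L" and C: "copy_edges z x y M L \<subseteq> X"
    by (auto simp: has_copy_def)
  have sh: "z \<noteq> x" "z \<noteq> y" "x \<noteq> y" "z \<notin> M" "x \<notin> M" "y \<notin> M" "finite M" "card M = t + 1"
    using Sh by (auto simp: copy_shape_def)
  have ed: "\<And>m. m \<in> M \<Longrightarrow> {z, x, m} \<in> X" "\<And>m. m \<in> M \<Longrightarrow> {z, y, m} \<in> X"
    using C by (auto simp: copy_edges_def)
  have fr: "p \<notin> W" "b \<notin> W" "finite W" "b \<noteq> p" "b \<notin> \<Union> E"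
    using frame by (auto simp: frame_def)
  have finS: "finite S" using finite_subset[OF S(1) fr(3)] .
  have pb: "p \<notin> S \<union> V" "b \<notin> S \<union> V" using fr(1,2) S(1) V(2,3) by blast+
  show False
  proof (cases r)
    case (Some r')
    obtain c a d where r: "r = Some (c, a, d)" using Some by (cases r') auto
    have fr': "c \<noteq> a" "c \<noteq> d" "a \<noteq> d" "E \<subseteq> guard r" "p \<notin> {a, d, c}" "b \<notin> {a, d, c}"
      using frame r by (auto simp: frame_def)
    have X1': "X1 \<subseteq> guard (Some (c, a, d)) \<union> (\<lambda>s. {p, b, s}) ` S \<union> {f}" using X1 fr'(4) r by blast
    have comm: "{b, p, s} = {p, b, s}" for s by blast
    consider "z \<noteq> p" "z \<noteq> b" | "z = p" "b \<noteq> x" | "z = p" "b \<noteq> y" | "z = b" "p \<noteq> x" | "z = b" "p \<noteq> y"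
      using sh(3) by blast
    then show False
    proof cases
      case 1
      \<comment> \<open>A centre other than \<open>p\<close> and \<open>b\<close> lies in at most
        one edge through both, so three edges outside the guard suffice, and
        \<open>3 \<le> t\<close>.\<close>
      have "e \<in> guard (Some (c, a, d)) \<union> {f, g, {p, b, z}}" if e: "e \<in> X" "z \<in> e" for e
      proof -
        have im: "e = {p, b, z}" if "e \<in> (\<lambda>s. {p, b, s}) ` N" for N using that 1 e(2) by auto
        have "(e \<in> X1 \<or> e \<in> (\<lambda>v. {p, b, v}) ` V) \<or> e = g"
          using subsetD[OF X e(1)] unfolding Un_iff singleton_iff .
        moreover have "(e \<in> guard (Some (c, a, d)) \<or> e \<in> (\<lambda>s. {p, b, s}) ` S) \<or> e = f" if "e \<in> X1"
          using subsetD[OF X1' that] unfolding Un_iff singleton_iff .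
        ultimately show ?thesis using im[of S] im[of V] by blast
      qed
      then show False
        using no_cone_near_guard[OF t fr'(1-3) sh ed _ _ _ common_le_potential[OF pot(3,4,2) pot(1)[unfolded r]], of "{f, g, {p, b, z}}"]
          card_3_le[of f g "{p, b, z}"] t by simp
    next
      case 2
      show False
        by (rule no_cone_at_kernel[OF t sh ed, of b a d c S V X1 f g])
          (use 2 fr(4) fr'(5,6) finS S(2) V(1) pb X1' X in simp_all)
    next
      case 3
      show False
        by (rule no_cone_at_kernel[OF t sh(2,1) sh(3)[symmetric] sh(4,6,5,7,8) ed(2,1), of b a d c S V X1 f g])
          (use 3 fr(4) fr'(5,6) finS S(2) V(1) pb X1' X in simp_all)
    next
      case 4
      show False
        by (rule no_cone_at_kernel[OF t sh ed, of p a d c S V X1 f g])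
          (use 4 fr(4) fr'(5,6) finS S(2) V(1) pb X1' X in \<open>simp_all add: comm\<close>)
    next
      case 5
      show False
        by (rule no_cone_at_kernel[OF t sh(2,1) sh(3)[symmetric] sh(4,6,5,7,8) ed(2,1), of p a d c S V X1 f g])
          (use 5 fr(4) fr'(5,6) finS S(2) V(1) pb X1' X in \<open>simp_all add: comm\<close>)
    qed
  next
    case None
    have fN: "\<not> has_copy t (E \<union> F)" if "finite F" "card F \<le> t" for F
      using frame None that by (simp add: frame_def)
    note frame' = frame[unfolded None]
    have X1': "X1 \<subseteq> E \<union> (\<lambda>s. {p, b, s}) ` S \<union> {f}" using X1 None by simp
    define D where "D = copy_edges z x y M L"
    define K where "K = D \<inter> (\<lambda>s. {p, b, s}) ` (S \<union> V)"
    have finD: "finite D" using C pot(3) finite_subset unfolding D_def by blast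
    then have finK: "finite K" by (simp add: K_def)
    \<comment> \<open>By the frame, \<open>E\<close> cannot be completed by \<open>t\<close> edges,
      so the copy has at least two edges through both \<open>p\<close> and \<open>b\<close>. The
      centre lies in both, hence is \<open>p\<close> or \<open>b\<close>.\<close>
    have "D \<subseteq> E \<union> (K \<union> {f, g})" using C X X1' unfolding K_def D_def by blast
    then have "has_copy t (E \<union> (K \<union> {f, g}))" unfolding has_copy_def D_def using Sh by blast
    then have "\<not> card (K \<union> {f, g}) \<le> t" using fN[of "K \<union> {f, g}"] finK by auto
    moreover have "card (K \<union> {f, g}) \<le> card K + card {f, g}" by (rule card_Un_le)
    moreover have "card {f, g} \<le> 2" by (simp add: card_insert_if)
    ultimately have "\<not> card K \<le> Suc 0" using t by linarith
    then obtain e e' where ee: "e \<in> K" "e' \<in> K" "e \<noteq> e'" using card_le_Suc0_iff_eq[OF finK] by blast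
    have zD: "z \<in> e" if "e \<in> D" for e using that by (auto simp: D_def copy_edges_def)
    have Kpb: "p \<in> k \<and> b \<in> k" if "k \<in> K" for k using that by (auto simp: K_def)
    have D_cases: "\<exists>m. k = {z, x, m} \<and> m \<in> M \<union> L \<or> k = {z, y, m} \<and> m \<in> M" if "k \<in> K" for k
      using that unfolding K_def D_def copy_edges_def by blast
    have zpb: "z = p \<or> z = b"
    proof (rule ccontr)
      assume nz: "\<not> (z = p \<or> z = b)"
      have "k = {p, b, z}" if "k \<in> K" for k
        using that zD[of k] nz by (auto simp: K_def)
      then show False using ee by blast
    qed
    show False
    proof (cases "z = b")
      case True
      \<comment> \<open>No edge of \<open>E\<close> contains \<open>b\<close>. A hub other than
        \<open>p\<close> would thus have only \<open>f\<close> and \<open>g\<close> for its at least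
        \<open>t\<close> edges that avoid \<open>p\<close>.\<close>
      have one: False if h: "h \<noteq> p" "h \<noteq> z" "h \<notin> M" "\<And>m. m \<in> M \<Longrightarrow> {z, h, m} \<in> X" for h
      proof -
        have "{z, h, m} \<in> {f, g}" if "m \<in> M - {p}" for m
        proof -
          have "p \<notin> {z, h, m}" using that h True fr(4) by auto
          moreover have "b \<in> {z, h, m}" using True by simp
          moreover have "{z, h, m} \<in> X" using that h by blast
          ultimately show ?thesis using X X1' fr(5) by blast
        qed
        then have "card (M - {p}) \<le> card {f, g}"
          using sh h by (intro triples_card_le[of z _ h]) auto
        moreover have "card (M - {p}) \<ge> t" using sh by (simp add: card_Diff_singleton_if)
        ultimately show False using t \<open>card {f, g} \<le> 2\<close> by linarith
      qed
      show False using one[of x] one[of y] sh ed by metis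
    next
      case False
      then have zp: "z = p" using zpb by blast
      consider "b = x" | "b = y" | "b \<in> M" | "b \<noteq> x" "b \<noteq> y" "b \<notin> M" by blast
      then show False
      proof cases
        case 1
        show False
          by (rule no_hub_pair_at_kernel[OF t frame', of y M X S V X1 f g])
            (use sh ed 1 zp S V X1' X w1 in simp_all)
      next
        case 2
        show False
          by (rule no_hub_pair_at_kernel[OF t frame', of x M X S V X1 f g])
            (use sh ed 2 zp S V X1' X w1 in simp_all)
      next
        case 3
        have bxy: "b \<noteq> x" "b \<noteq> y" using 3 sh by auto
        have "k = {p, x, b} \<or> k = {p, y, b}" if k: "k \<in> K" for k
        proof -
          obtain m where m: "k = {p, x, m} \<or> k = {p, y, m}" using D_cases[OF k] zp by blast
          then have "m = b" using Kpb[OF k] fr(4) bxy by blast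
          then show ?thesis using m by blast
        qed
        then have "{p, x, b} \<in> K" "{p, y, b} \<in> K" using ee by metis+
        then have "{p, b, x} \<in> (\<lambda>s. {p, b, s}) ` (S \<union> V)" "{p, b, y} \<in> (\<lambda>s. {p, b, s}) ` (S \<union> V)"
          unfolding K_def by (simp_all add: insert_commute)
        moreover have "{p, b, h} \<in> (\<lambda>s. {p, b, s}) ` (S \<union> V) \<longleftrightarrow> h \<in> S \<union> V" if "p \<noteq> h" "b \<noteq> h" for h
          by (rule triple_in_image) (use that pb in auto)
        ultimately have "x \<in> S \<union> V" "y \<in> S \<union> V" using bxy sh(1,2) zp by auto
        then show False
          using no_mid_at_kernel[OF t frame' _ _ sh(3) _ sh(5-8) 3 _ _ S(1) _ _ V(1) X1' X] sh ed zp by auto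
      next
        case 4
        have "k = {p, x, b}" if k: "k \<in> K" for k
        proof -
          obtain m where m: "k = {p, x, m} \<or> k = {p, y, m} \<and> m \<in> M" using D_cases[OF k] zp by blast
          then have "m = b" using Kpb[OF k] fr(4) 4 by blast
          then show ?thesis using m 4 by blast
        qed
        then show False using ee by metis
      qed
    qed
  qed
qed

section \<open>The potential\<close>

lemma half_insert_same:
  assumes "\<And>v. v \<notin> {a, d, c} \<Longrightarrow> e \<noteq> {c, a, v}"
  shows "half c a d (insert e X) Y = half c a d X Y"
proof -
  have "{c, a, v} \<in> insert e X \<longleftrightarrow> {c, a, v} \<in> X" if "v \<notin> {a, d, c}" for v
    using assms[OF that] by blast
  then show ?thesis unfolding half_def by blast
qed

lemma card_half_insert:
  assumes "finite X" "X \<subseteq> board3"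
  shows "card (half c a d (insert e X) Y) \<le> card (half c a d X Y) + 1"
proof (cases "\<exists>v. v \<notin> {a, d, c} \<and> e = {c, a, v}")
  case False
  then have "half c a d (insert e X) Y = half c a d X Y" by (intro half_insert_same) blast
  then show ?thesis by simp
next
  case True
  then obtain v where v: "v \<notin> {a, d, c}" "e = {c, a, v}" by blast
  have "half c a d (insert e X) Y \<subseteq> insert v (half c a d X Y)"
  proof
    fix u assume u: "u \<in> half c a d (insert e X) Y"
    then have "u \<notin> {a, d, c}" "{c, a, u} \<in> insert e X" "{c, d, u} \<notin> Y" by (simp_all add: half_def)
    moreover have "u = v" if "{c, a, u} = e"
    proof -
      have "u \<in> {c, a, v}" using that v by blast
      then show ?thesis using \<open>u \<notin> {a, d, c}\<close> by auto
    qed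
    ultimately show "u \<in> insert v (half c a d X Y)" by (auto simp: half_def)
  qed
  then have "card (half c a d (insert e X) Y) \<le> card (insert v (half c a d X Y))"
    using finite_half[OF assms] by (intro card_mono) auto
  also have "\<dots> \<le> card (half c a d X Y) + 1"
    using finite_half[OF assms] by (simp add: card_insert_if)
  finally show ?thesis .
qed

text \<open>An edge through \<open>d\<close> is never counted in the half of \<open>a\<close>, and
  an edge avoiding \<open>d\<close> never in the half of \<open>d\<close>; one move enlarges only
  one half.\<close>

lemma potential_insert_le:
  assumes "frame t r E p q b W w1" "finite X" "X \<subseteq> board3"
  shows "potential r (insert e X) Y \<le> potential r X Y + 1"
proof (cases r)
  case (Some r')
  obtain c a d where r: "r = Some (c, a, d)" using Some by (cases r') auto
  have d: "c \<noteq> a" "c \<noteq> d" "a \<noteq> d" using assms(1) r by (auto simp: frame_def)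
  show ?thesis
  proof (cases "d \<in> e")
    case True
    have "e \<noteq> {c, a, v}" if "v \<notin> {a, d, c}" for v using True d that by blast
    then have "half c a d (insert e X) Y = half c a d X Y" by (rule half_insert_same)
    then show ?thesis using card_half_insert[OF assms(2,3), of c d a e Y] r by simp
  next
    case False
    have "e \<noteq> {c, d, v}" if "v \<notin> {d, a, c}" for v using False by blast
    then have "half c d a (insert e X) Y = half c d a X Y" by (rule half_insert_same)
    then show ?thesis using card_half_insert[OF assms(2,3), of c a d e Y] r by simp
  qed
qed simp

lemma potential_insert_outside:
  assumes "e \<notin> guard r"
  shows "potential r (insert e X) Y = potential r X Y"
proof (cases r)
  case (Some r')
  obtain c a d where r: "r = Some (c, a, d)" using Some by (cases r') auto
  have "{c, a, v} \<in> guard r" "{c, d, v} \<in> guard r" if "v \<notin> {a, d, c}" for v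
    using that r by (auto simp: guard.simps)
  then have "half c a d (insert e X) Y = half c a d X Y" "half c d a (insert e X) Y = half c d a X Y"
    using assms by (intro half_insert_same; blast)+
  then show ?thesis using r by simp
qed simp

lemma half_antimono: "half c a d X (insert e Y) \<subseteq> half c a d X Y"
  by (auto simp: half_def)

lemma potential_antimono:
  assumes "finite X" "X \<subseteq> board3"
  shows "potential r X (insert e Y) \<le> potential r X Y"
proof (cases r)
  case (Some r')
  obtain c a d where r: "r = Some (c, a, d)" using Some by (cases r') auto
  show ?thesis unfolding r potential.simps
    by (intro add_mono card_mono finite_half assms half_antimono)
qed simp

text \<open>As \<open>{c, a, v}\<close> is in \<open>X\<close>, it is not in \<open>Y\<close>; if
  \<open>X\<close> also contained the partner, \<open>v\<close> would lie in both halves. Taking the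
  partner removes \<open>v\<close> from one half and cannot enlarge the other.\<close>

lemma reply_half:
  assumes X: "finite X" "X \<subseteq> board3" "X \<inter> Y = {}" and d: "c \<noteq> a" "c \<noteq> d" "a \<noteq> d"
    and v: "v \<in> half c a d X Y" "v \<notin> half c d a X Y"
  shows "{c, d, v} \<in> guard (Some (c, a, d))" "{c, d, v} \<in> board3" "{c, d, v} \<notin> X \<union> Y"
    "potential (Some (c, a, d)) X (insert {c, d, v} Y) < potential (Some (c, a, d)) X Y"
proof -
  have v': "v \<notin> {a, d, c}" "{c, a, v} \<in> X" "{c, d, v} \<notin> Y" using v(1) by (auto simp: half_def)
  show "{c, d, v} \<in> guard (Some (c, a, d))" using v' unfolding guard.simps by blast
  show "{c, d, v} \<in> board3" using v' d by (simp add: board3_def)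
  have "{c, a, v} \<notin> Y" using v' X by blast
  then have "{c, d, v} \<notin> X" using v(2) v' unfolding half_def by blast
  then show "{c, d, v} \<notin> X \<union> Y" using v' by blast
  have "half c a d X (insert {c, d, v} Y) \<subset> half c a d X Y"
    using half_antimono v(1) unfolding half_def by blast
  then have "card (half c a d X (insert {c, d, v} Y)) < card (half c a d X Y)"
    using finite_half[OF X(1,2)] psubset_card_mono by blast
  moreover have "card (half c d a X (insert {c, d, v} Y)) \<le> card (half c d a X Y)"
    using finite_half[OF X(1,2)] half_antimono by (intro card_mono)
  ultimately show "potential (Some (c, a, d)) X (insert {c, d, v} Y) < potential (Some (c, a, d)) X Y"
    by simp
qed

text \<open>Equal halves would make the potential even, so some vertex lies in exactly one of
  them.\<close>

lemma potential_reply: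
  assumes "frame t r E p q b W w1" and X: "finite X" "X \<subseteq> board3" "X \<inter> Y = {}"
    and odd: "odd (potential r X Y)"
  shows "\<exists>e'\<in>guard r. e' \<in> board3 \<and> e' \<notin> X \<union> Y \<and> potential r X (insert e' Y) < potential r X Y"
proof (cases r)
  case None
  then show ?thesis using odd by simp
next
  case (Some r')
  obtain c a d where r: "r = Some (c, a, d)" using Some by (cases r') auto
  have d: "c \<noteq> a" "c \<noteq> d" "a \<noteq> d" using assms(1) r by (auto simp: frame_def)
  have "half c a d X Y \<noteq> half c d a X Y"
  proof
    assume "half c a d X Y = half c d a X Y"
    then have "potential r X Y = 2 * card (half c a d X Y)" using r by simp
    then show False using odd by simp
  qed
  then consider v where "v \<in> half c a d X Y" "v \<notin> half c d a X Y"
    | v where "v \<in> half c d a X Y" "v \<notin> half c a d X Y" by blast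
  then show ?thesis
  proof cases
    case 1
    show ?thesis using reply_half[OF X d 1] r by blast
  next
    case 2
    have g: "guard (Some (c, d, a)) = guard (Some (c, a, d))" unfolding guard.simps by blast
    have p: "potential (Some (c, d, a)) X Y' = potential (Some (c, a, d)) X Y'" for Y' by simp
    show ?thesis using reply_half[OF X d(2,1) d(3)[symmetric] 2] r unfolding g p by blast
  qed
qed

lemma potential_le_card:
  assumes "c \<noteq> a" "c \<noteq> d" "a \<noteq> d" "finite X" "X \<subseteq> board3"
  shows "potential (Some (c, a, d)) X Y \<le> card X"
proof -
  let ?A = "(\<lambda>v. {c, a, v}) ` half c a d X Y" and ?B = "(\<lambda>v. {c, d, v}) ` half c d a X Y"
  have inA: "a \<in> e" if "e \<in> ?A" for e using that by blast
  have notB: "a \<notin> e" if "e \<in> ?B" for e using that assms(1,3) by (auto simp: half_def)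
  have "?A \<inter> ?B = {}"
  proof (rule equals0I)
    fix e assume "e \<in> ?A \<inter> ?B"
    then show False using inA[OF IntD1] notB[OF IntD2] by metis
  qed
  moreover have "finite ?A" "finite ?B" using finite_half[OF assms(4,5)] by blast+
  ultimately have "card (?A \<union> ?B) = card ?A + card ?B" by (intro card_Un_disjoint)
  moreover have "card ?A = card (half c a d X Y)" by (rule card_triples) (auto simp: half_def)
  moreover have "card ?B = card (half c d a X Y)" by (rule card_triples) (auto simp: half_def)
  moreover have "card (?A \<union> ?B) \<le> card X" using assms(4) by (intro card_mono) (auto simp: half_def)
  ultimately show ?thesis by simp
qed

text \<open>A guard edge has two vertices among \<open>c\<close>, \<open>a\<close>,
  \<open>d\<close>, but \<open>p\<close> and \<open>b\<close> are none of these. Hence blocking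
  moves leave the potential unchanged, and replies in the guard never occupy an edge
  \<open>{p, b, w}\<close>.\<close>

lemma kernel_not_guard:
  assumes "frame t r E p q b W w1"
  shows "{p, b, w} \<notin> guard r"
proof (cases r)
  case (Some r')
  obtain c a d where r: "r = Some (c, a, d)" using Some by (cases r') auto
  have d: "c \<noteq> a" "c \<noteq> d" "p \<notin> {a, d, c}" "b \<notin> {a, d, c}" using assms(1) r by (auto simp: frame_def)
  show ?thesis using guard_Some_mem[of "{p, b, w}" c a d] d r by auto
qed simp

section \<open>The position at the end of the star phase\<close>

lemma card_less_no_copy:
  assumes "t \<ge> 2" "finite X" "card X < 3 * t"
  shows "\<not> has_copy t X"
proof
  assume "has_copy t X"
  then obtain z x y M L where "copy_shape (t + 1) (t - 2) z x y M L" "copy_edges z x y M L \<subseteq> X"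
    by (auto simp: has_copy_def)
  then have "2 * (t + 1) + (t - 2) \<le> card X"
    using card_copy_edges card_mono[OF assms(2)] by metis
  then show False using assms by simp
qed

text \<open>The existence of a completion by \<open>t\<close> edges decides \<open>r\<close>. The
  set \<open>B\<close> will be the vertices already touched by the second player, so that no edge
  through \<open>b\<close> has been claimed.\<close>

lemma frame_exists:
  assumes t: "t \<ge> 3" and E: "finite E" "card E = 2 * t" "E \<subseteq> board3" "e1 \<in> E"
    and W: "p \<noteq> q" "p \<notin> W" "q \<notin> W" "finite W" "card W = 2 * t - 1" "\<And>w. w \<in> W \<Longrightarrow> {p, q, w} \<notin> E"
    and e1: "e1 \<inter> ({p, q} \<union> W) = {}" and B: "finite B"
  shows "\<exists>r p' q' b w1. {p', q'} = {p, q} \<and> frame t r E p' q' b W w1 \<and> b \<notin> B \<and> potential r E Y \<le> 2 * t"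
proof -
  have finE: "finite (\<Union> E)"
  proof -
    have "finite e" if "e \<in> E" for e
      using E(3) that by (intro card_ge_0_finite) (auto simp: board3_def)
    then show ?thesis using E(1) by blast
  qed
  have W0: "W \<noteq> {}" using W t by auto
  show ?thesis
  proof (cases "\<exists>F. finite F \<and> card F \<le> t \<and> has_copy t (E \<union> F)")
    case True
    then obtain F z x y M L where F: "finite F" "card F \<le> t"
      and Sh: "copy_shape (t + 1) (t - 2) z x y M L" and C: "copy_edges z x y M L \<subseteq> E \<union> F"
      by (auto simp: has_copy_def)
    let ?D = "copy_edges z x y M L"
    have "card ?D \<le> card ((E \<inter> ?D) \<union> F)" using C F E by (intro card_mono) auto
    also have "\<dots> \<le> card (E \<inter> ?D) + card F" by (rule card_Un_le)
    \<comment> \<open>The copy has \<open>3 * t\<close> edges, at most \<open>t\<close> of them in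
      \<open>F\<close>; the rest exhausts \<open>E\<close>.\<close>
    finally have "2 * t \<le> card (E \<inter> ?D)" using F card_copy_edges[OF Sh] t by simp
    then have "E \<inter> ?D = E" using E by (intro card_seteq) auto
    then have ED: "E \<subseteq> ?D" by blast
    have D: "\<exists>h m. e = {z, h, m} \<and> h \<in> {x, y} \<and> m \<notin> {x, y, z}" if "e \<in> ?D" for e
    proof -
      have "m \<notin> {x, y, z}" if "m \<in> M \<union> L" for m using Sh that by (auto simp: copy_shape_def)
      then show ?thesis using that unfolding copy_edges_def by blast
    qed
    have dist: "z \<noteq> x" "z \<noteq> y" "x \<noteq> y" using Sh by (auto simp: copy_shape_def)
    have "E \<subseteq> guard (Some (z, x, y))" using ED D unfolding guard.simps by blast
    obtain h m where h: "e1 = {z, h, m}" "h \<in> {x, y}" using D E ED by blast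
    \<comment> \<open>The edge \<open>e1\<close> avoids \<open>p\<close> and \<open>q\<close> but
      contains the centre and one hub, so at most one of \<open>p\<close>, \<open>q\<close> can be
      the other hub.\<close>
    then have hz: "h \<notin> {p, q}" "z \<notin> {p, q}" using e1 by auto
    obtain p' q' where p': "{p', q'} = {p, q}" "p' \<notin> {x, y}"
    proof (cases "p \<in> {x, y}")
      case True
      then have "q \<notin> {x, y}" using h(2) hz W(1) by auto
      then show ?thesis using that[of q p] by blast
    next
      case False
      then show ?thesis using that[of p q] by blast
    qed
    have "p' = p \<and> q' = q \<or> p' = q \<and> q' = p" using p'(1) by (simp add: doubleton_eq_iff)
    then have pq: "p' \<noteq> q'" "p' \<notin> W" "q' \<notin> W" "p' \<noteq> z" using W(1-3) hz by auto
    obtain b where b: "b \<notin> {p', q'} \<union> W \<union> \<Union> E \<union> {x, y, z} \<union> B"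
      using ex_new_if_finite[OF infinite_UNIV_nat, of "{p', q'} \<union> W \<union> \<Union> E \<union> {x, y, z} \<union> B"] finE W(4) B by auto
    obtain w1 where "w1 \<in> W" using W0 by blast
    have "frame t (Some (z, x, y)) E p' q' b W w1"
      unfolding frame_def using pq W(4,5) \<open>w1 \<in> W\<close> b E(1,3) dist p'(2) \<open>E \<subseteq> guard _\<close> by simp
    moreover have "potential (Some (z, x, y)) E Y \<le> 2 * t"
      using potential_le_card[OF dist E(1,3)] E(2) by metis
    ultimately show ?thesis using p'(1) b by blast
  next
    case False
    obtain p' q' where p': "{p', q'} = {p, q}" "card {e \<in> E. p' \<in> e} \<le> card {e \<in> E. q' \<in> e}"
    proof (cases "card {e \<in> E. p \<in> e} \<le> card {e \<in> E. q \<in> e}")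
      case True
      then show ?thesis using that[of p q] by blast
    next
      case False
      then show ?thesis using that[of q p] by (simp add: insert_commute)
    qed
    have eq: "p' = p \<and> q' = q \<or> p' = q \<and> q' = p" using p'(1) by (simp add: doubleton_eq_iff)
    then have pq: "p' \<noteq> q'" "p' \<notin> W" "q' \<notin> W" "p' \<notin> e1" "q' \<notin> e1" using W(1-3) e1 by auto
    have star: "{p', q', w} \<notin> E" if "w \<in> W" for w
      using W(6)[OF that] eq by (auto simp: insert_commute)
    obtain b where b: "b \<notin> {p', q'} \<union> W \<union> \<Union> E \<union> B"
      using ex_new_if_finite[OF infinite_UNIV_nat, of "{p', q'} \<union> W \<union> \<Union> E \<union> B"] finE W(4) B by auto
    obtain w1 where w1: "w1 \<in> W" "(\<exists>w\<in>W. \<exists>e\<in>E. p' \<in> e \<and> w \<in> e) \<longrightarrow> (\<exists>e\<in>E. p' \<in> e \<and> w1 \<in> e)"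
      using W0 by blast
    have "frame t None E p' q' b W w1"
      unfolding frame_def using pq W(4,5) w1 b E p'(2) False star by auto
    then show ?thesis using p'(1) b by (metis potential.simps(1) UnCI zero_le)
  qed
qed

section \<open>The stages of the strategy\<close>

definition star_stage :: "nat \<Rightarrow> nat set set \<Rightarrow> nat set set \<Rightarrow> bool" where
  "star_stage t X Y \<longleftrightarrow> (\<exists>e1 p q W. e1 \<in> X \<and> p \<noteq> q \<and> p \<notin> W \<and> q \<notin> W \<and> finite W \<and> card W = card X \<and>
     card X \<le> 2 * t - 1 \<and> Y = (\<lambda>w. {p, q, w}) ` W \<and> e1 \<inter> ({p, q} \<union> W) = {})"

text \<open>The strict inequality compares the opponent's moves outside \<open>E\<close> and the
  guard with the edges \<open>{p, b, w}\<close> of the second player. A reply inside the guard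
  answers a guard move and so changes neither count.\<close>

definition slot_stage :: "nat \<Rightarrow> nat set set \<Rightarrow> nat set set \<Rightarrow> bool" where
  "slot_stage t X Y \<longleftrightarrow> (\<exists>r E p q b W w1. frame t r E p q b W w1 \<and>
     (\<forall>w\<in>W. {p, q, w} \<in> Y) \<and> {p, b, w1} \<in> Y \<and> card {w \<in> W. {p, b, w} \<in> Y} \<le> t \<and>
     card (X - (E \<union> guard r)) < card {w \<in> W. {p, b, w} \<in> Y} \<and> potential r X Y \<le> 2 * t)"

text \<open>The leaves in \<open>S\<close> are blocked, \<open>V\<close> records the answered
  threats, \<open>f\<close> is the one move the opponent had to spare, and \<open>v\<close> carries
  the pending threat, to be completed by \<open>{p, b, v}\<close>.\<close>

definition threat_stage :: "nat \<Rightarrow> nat set set \<Rightarrow> nat set set \<Rightarrow> bool" where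
  "threat_stage t X Y \<longleftrightarrow> (\<exists>r E p q b W w1 S V X1 f v. frame t r E p q b W w1 \<and>
     S \<subseteq> W \<and> card S = t - 1 \<and> w1 \<notin> S \<and> V \<inter> \<Union> X1 = {} \<and> p \<notin> V \<and> b \<notin> V \<and>
     X1 \<subseteq> E \<union> guard r \<union> (\<lambda>s. {p, b, s}) ` S \<union> {f} \<and> X = X1 \<union> (\<lambda>v. {p, b, v}) ` V \<and>
     potential r X Y \<le> 2 * t \<and> (\<forall>w\<in>insert v W. {p, q, w} \<in> Y) \<and> (\<forall>w\<in>W - S. {p, b, w} \<in> Y) \<and>
     {p, b, v} \<notin> X \<union> Y \<and> v \<notin> {p, q, b} \<union> W \<union> \<Union> X1)"

lemma card_le_one_subset_singleton:
  assumes "finite Q" "card Q \<le> Suc 0"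
  obtains g where "Q \<subseteq> {g}"
  using assms card_le_Suc0_iff_eq[of Q] by blast

lemma fresh_vertex:
  assumes "finite X" "X \<subseteq> board3" "finite B"
  obtains v where "v \<notin> B" "v \<notin> \<Union> X"
proof -
  have "finite e" if "e \<in> X" for e
    using assms(2) that by (intro card_ge_0_finite) (auto simp: board3_def)
  then have "finite (B \<union> \<Union> X)" using assms by blast
  then obtain v where "v \<notin> B \<union> \<Union> X" using ex_new_if_finite[OF infinite_UNIV_nat] by blast
  then show ?thesis using that by blast
qed

lemma has_copyI:
  assumes "p \<noteq> q" "p \<noteq> b" "q \<noteq> b" "{p, q, b} \<inter> (M \<union> L) = {}" "M \<inter> L = {}" "finite M" "finite L"
    "card M = t + 1" "card L = t - 2" "\<And>m. m \<in> M \<union> L \<Longrightarrow> {p, q, m} \<in> Y" "\<And>m. m \<in> M \<Longrightarrow> {p, b, m} \<in> Y"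
  shows "has_copy t Y"
proof -
  have "copy_shape (t + 1) (t - 2) p q b M L" using assms(1-9) by (simp add: copy_shape_def)
  moreover have "copy_edges p q b M L \<subseteq> Y" using assms(10,11) by (auto simp: copy_edges_def)
  ultimately show ?thesis unfolding has_copy_def by blast
qed

lemma triple_board3: "p \<noteq> q \<Longrightarrow> p \<noteq> w \<Longrightarrow> q \<noteq> w \<Longrightarrow> {p, q, w} \<in> board3"
  by (simp add: board3_def)

section \<open>The replies of the second player, stage by stage\<close>

lemma start_step:
  assumes "t \<ge> 3" "e \<in> board3"
  shows "\<not> has_copy t {e} \<and> (\<exists>e'\<in>board3. e' \<notin> {e} \<and> star_stage t {e} {e'})"
proof -
  obtain p where p: "p \<notin> e" using fresh_vertex[of "{e}" "{}"] assms by auto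
  obtain q where q: "q \<notin> e" "q \<noteq> p" using fresh_vertex[of "{e}" "{p}"] assms by auto
  obtain w where w: "w \<notin> e" "w \<noteq> p" "w \<noteq> q" using fresh_vertex[of "{e}" "{p, q}"] assms by auto
  have "star_stage t {e} {{p, q, w}}"
    unfolding star_stage_def
    by (rule exI[of _ e], rule exI[of _ p], rule exI[of _ q], rule exI[of _ "{w}"]) (use p q w assms in auto)
  moreover have "{p, q, w} \<in> board3" using q w by (intro triple_board3) auto
  moreover have "{p, q, w} \<notin> {e}" using p by blast
  moreover have "\<not> has_copy t {e}" using assms by (intro card_less_no_copy) auto
  ultimately show ?thesis by (intro conjI bexI[of _ "{p, q, w}"])
qed

lemma star_step:
  assumes t: "t \<ge> 3" and st: "star_stage t X Y"
    and X: "finite X" "X \<subseteq> board3" and Y: "finite Y" "Y \<subseteq> board3" and dis: "X \<inter> Y = {}"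
    and e: "e \<in> board3" "e \<notin> X \<union> Y"
  shows "\<not> has_copy t (insert e X) \<and>
    (\<exists>e'\<in>board3. e' \<notin> insert e X \<union> Y \<and> (star_stage t (insert e X) (insert e' Y) \<or> slot_stage t (insert e X) (insert e' Y)))"
proof -
  obtain e1 p q W where s: "e1 \<in> X" "p \<noteq> q" "p \<notin> W" "q \<notin> W" "finite W" "card W = card X"
     "card X \<le> 2 * t - 1" "Y = (\<lambda>w. {p, q, w}) ` W" "e1 \<inter> ({p, q} \<union> W) = {}"
    using st unfolding star_stage_def by blast
  let ?X = "insert e X"
  have cX: "card ?X = Suc (card X)" using e X by simp
  have X': "finite ?X" "?X \<subseteq> board3" using X e by auto
  have nc: "\<not> has_copy t ?X" using cX s(7) X' t by (intro card_less_no_copy) auto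
  show ?thesis
  proof (cases "card X = 2 * t - 1")
    case False
    obtain w where w: "w \<notin> {p, q} \<union> W \<union> e1" "w \<notin> \<Union> (?X \<union> Y)"
    proof (rule fresh_vertex[of "?X \<union> Y" "{p, q} \<union> W \<union> e1"])
      have "e1 \<in> board3" using s(1) X by blast
      then have "finite e1" by (intro card_ge_0_finite) (simp add: board3_def)
      then show "finite ({p, q} \<union> W \<union> e1)" using s(5) by simp
    qed (use X' Y in auto)
    have "star_stage t ?X (insert {p, q, w} Y)"
      unfolding star_stage_def
    proof (rule exI[of _ e1], rule exI[of _ p], rule exI[of _ q], rule exI[of _ "insert w W"], intro conjI)
      show "card (insert w W) = card ?X" using w s(5,6) cX by simp
      show "card ?X \<le> 2 * t - 1" using cX s(7) False by simp
      show "insert {p, q, w} Y = (\<lambda>w. {p, q, w}) ` insert w W" using s(8) by simp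
    qed (use s(1-5,9) w in auto)
    moreover have "{p, q, w} \<in> board3" using s(2) w by (intro triple_board3) auto
    moreover have "{p, q, w} \<notin> ?X \<union> Y" using w(2) by blast
    ultimately show ?thesis using nc by (intro conjI bexI[of _ "{p, q, w}"] disjI1)
  next
    case True
    have star: "{p, q, w} \<notin> ?X" if "w \<in> W" for w
    proof -
      have "{p, q, w} \<in> Y" using that s(8) by blast
      then show ?thesis using dis e(2) by blast
    qed
    have fY: "finite (\<Union> Y)"
    proof -
      have "finite y" if "y \<in> Y" for y
        using Y(2) that by (intro card_ge_0_finite) (auto simp: board3_def)
      then show ?thesis using Y(1) by blast
    qed
    \<comment> \<open>The star is complete and the opponent has just made move \<open>2 * t\<close>:
      now the frame is fixed and the first edge at \<open>b\<close> claimed.\<close>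
    have c2: "card ?X = 2 * t" using cX True t by simp
    have cW: "card W = 2 * t - 1" using s(6) True by simp
    obtain r p' q' b w1 where fr: "{p', q'} = {p, q}" "frame t r ?X p' q' b W w1" "b \<notin> \<Union> Y"
      "potential r ?X Y \<le> 2 * t"
      using frame_exists[OF t X'(1) c2 X'(2) insertI2[OF s(1)] s(2-5) cW star s(9) fY, of Y] by metis
    let ?e = "{p', b, w1}"
    have f: "p' \<noteq> b" "p' \<noteq> w1" "b \<noteq> w1" "b \<notin> \<Union> ?X" "w1 \<in> W" "finite W"
      using fr(2) unfolding frame_def by auto
    have one: "w = w1" if "{p', b, w} \<in> insert ?e Y" "w \<in> W" for w
    proof -
      have "{p', b, w} \<notin> Y" using fr(3) by blast
      then have "{p', b, w} = ?e" using that by blast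
      then have "w \<in> {p', b, w1}" by blast
      then show ?thesis using fr(2) that(2) unfolding frame_def by auto
    qed
    then have "{w \<in> W. {p', b, w} \<in> insert ?e Y} = {w1}" using f(5) by blast
    then have cU: "card {w \<in> W. {p', b, w} \<in> insert ?e Y} = 1" by simp
    have "slot_stage t ?X (insert ?e Y)"
      unfolding slot_stage_def
    proof (rule exI[of _ r], rule exI[of _ ?X], rule exI[of _ p'], rule exI[of _ q'], rule exI[of _ b],
        rule exI[of _ W], rule exI[of _ w1], intro conjI)
      show "frame t r ?X p' q' b W w1" by (rule fr)
      show "\<forall>w\<in>W. {p', q', w} \<in> insert ?e Y"
      proof
        fix w assume "w \<in> W"
        have "{p', q', w} = {p, q, w}" using fr(1) by blast
        then show "{p', q', w} \<in> insert ?e Y" using \<open>w \<in> W\<close> s(8) by blast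
      qed
      have "?X - (?X \<union> guard r) = {}" by blast
      then have "card (?X - (?X \<union> guard r)) = 0" by (simp only: card.empty)
      then show "card (?X - (?X \<union> guard r)) < card {w \<in> W. {p', b, w} \<in> insert ?e Y}" unfolding cU by simp
      show "card {w \<in> W. {p', b, w} \<in> insert ?e Y} \<le> t" unfolding cU using t by simp
      show "potential r ?X (insert ?e Y) \<le> 2 * t" using potential_antimono[OF X'] fr(4) le_trans by blast
    qed simp
    moreover have "?e \<in> board3" using f by (intro triple_board3) auto
    moreover have "?e \<notin> ?X \<union> Y" using f(4) fr(3) by blast
    ultimately show ?thesis using nc by (intro conjI bexI[of _ ?e] disjI2)
  qed
qed

lemma slot_step:
  assumes t: "t \<ge> 3" and st: "slot_stage t X Y"
    and X: "finite X" "X \<subseteq> board3" and Y: "finite Y" "Y \<subseteq> board3" and dis: "X \<inter> Y = {}"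
    and e: "e \<in> board3" "e \<notin> X \<union> Y"
  shows "\<not> has_copy t (insert e X) \<and>
    (\<exists>e'\<in>board3. e' \<notin> insert e X \<union> Y \<and> (slot_stage t (insert e X) (insert e' Y) \<or>
      threat_stage t (insert e X) (insert e' Y) \<or> has_copy t (insert e' Y)))"
proof -
  obtain r E p q b W w1 where fr: "frame t r E p q b W w1"
    and star: "\<forall>w\<in>W. {p, q, w} \<in> Y" and w1Y: "{p, b, w1} \<in> Y" and Ut: "card {w \<in> W. {p, b, w} \<in> Y} \<le> t"
    and cO: "card (X - (E \<union> guard r)) < card {w \<in> W. {p, b, w} \<in> Y}" and pot: "potential r X Y \<le> 2 * t"
    using st unfolding slot_stage_def by blast
  define U where "U = {w \<in> W. {p, b, w} \<in> Y}"
  let ?X = "insert e X"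
  define R where "R = ?X - (E \<union> guard r)"
  have f: "p \<noteq> q" "p \<notin> W" "q \<notin> W" "finite W" "card W = 2 * t - 1" "w1 \<in> W" "b \<noteq> p" "b \<noteq> q" "b \<notin> W" "b \<notin> \<Union> E"
    using fr unfolding frame_def by auto
  have X': "finite ?X" "?X \<subseteq> board3" using X e by auto
  have dis': "?X \<inter> Y = {}" using dis e by blast
  have UW: "U \<subseteq> W" by (auto simp: U_def)
  have finU: "finite U" using UW f(4) finite_subset by blast
  have finR: "finite R" using X' by (simp add: R_def)
  have "R \<subseteq> insert e (X - (E \<union> guard r))" by (auto simp: R_def)
  then have "card R \<le> card (insert e (X - (E \<union> guard r)))" using X by (intro card_mono) auto
  also have "\<dots> \<le> Suc (card (X - (E \<union> guard r)))" using X by (simp add: card_insert_if)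
  finally have cR: "card R \<le> card U" using cO unfolding U_def by linarith
  have pot': "potential r ?X Y \<le> 2 * t + 1"
    using potential_insert_le[OF fr X, of e Y] pot by linarith
  have nc: "\<not> has_copy t ?X"
    by (rule no_copy_building[OF t fr, of ?X R Y])
      (use finR cR Ut X' dis' pot' in \<open>auto simp: R_def U_def\<close>)
  have ker: "{p, b, w} \<noteq> {p, b, w'}" if "w \<in> W" "w' \<noteq> w" for w w'
  proof -
    have "w \<notin> {p, b, w'}" using f(2,9) that by auto
    then show ?thesis by blast
  qed
  have "\<exists>e'\<in>board3. e' \<notin> ?X \<union> Y \<and> (slot_stage t ?X (insert e' Y) \<or>
      threat_stage t ?X (insert e' Y) \<or> has_copy t (insert e' Y))"
  proof (cases "potential r ?X Y \<le> 2 * t")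
    case False
    then have p1: "potential r ?X Y = 2 * t + 1" using pot' by simp
    have "e \<in> guard r"
    proof (rule ccontr)
      assume "e \<notin> guard r"
      then have "potential r ?X Y = potential r X Y" by (rule potential_insert_outside)
      then show False using p1 pot by simp
    qed
    \<comment> \<open>The move lay in the guard and raised the potential to exactly
      \<open>2 * t + 1\<close>; oddness provides the reply that restores the bound.\<close>
    have "odd (potential r ?X Y)" unfolding p1 by simp
    then obtain e' where e': "e' \<in> guard r" "e' \<in> board3" "e' \<notin> ?X \<union> Y"
      "potential r ?X (insert e' Y) < potential r ?X Y"
      using potential_reply[OF fr X' dis'] by blast
    have "{p, b, w} \<noteq> e'" for w using kernel_not_guard[OF fr, of w] e'(1) by blast
    then have "{p, b, w} \<in> insert e' Y \<longleftrightarrow> {p, b, w} \<in> Y" for w by blast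
    then have Ueq: "{w \<in> W. {p, b, w} \<in> insert e' Y} = U" unfolding U_def by simp
    have "slot_stage t ?X (insert e' Y)"
      unfolding slot_stage_def
    proof (rule exI[of _ r], rule exI[of _ E], rule exI[of _ p], rule exI[of _ q], rule exI[of _ b],
        rule exI[of _ W], rule exI[of _ w1], unfold Ueq, intro conjI)
      show "card U \<le> t" using Ut by (simp add: U_def)
      have "?X - (E \<union> guard r) = X - (E \<union> guard r)" using \<open>e \<in> guard r\<close> by blast
      then show "card (?X - (E \<union> guard r)) < card U" using cO by (simp add: U_def)
      show "potential r ?X (insert e' Y) \<le> 2 * t" using e'(4) p1 by simp
    qed (use fr star w1Y in auto)
    then show ?thesis using e' by blast
  next
    case pt: True
    show ?thesis
    proof (cases "\<exists>w\<in>W - U. {p, b, w} \<notin> ?X")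
      case True
      then obtain w where w: "w \<in> W" "w \<notin> U" "{p, b, w} \<notin> ?X" by blast
      let ?e = "{p, b, w}"
      have eb: "?e \<in> board3" using w(1) f(2,7,9) by (intro triple_board3) auto
      have eXY: "?e \<notin> ?X \<union> Y" using w by (auto simp: U_def)
      have Uw: "{u \<in> W. {p, b, u} \<in> insert ?e Y} = insert w U"
      proof (intro equalityI subsetI)
        fix u assume "u \<in> {u \<in> W. {p, b, u} \<in> insert ?e Y}"
        then have u: "u \<in> W" "{p, b, u} = ?e \<or> {p, b, u} \<in> Y" by blast+
        then show "u \<in> insert w U" using ker[OF w(1), of u] unfolding U_def by blast
      next
        fix u assume "u \<in> insert w U"
        then show "u \<in> {u \<in> W. {p, b, u} \<in> insert ?e Y}" using w(1) unfolding U_def by blast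
      qed
      have cUw: "card (insert w U) = Suc (card U)" using finU w(2) by simp
      show ?thesis
      proof (cases "card U = t")
        case False
        have "slot_stage t ?X (insert ?e Y)"
          unfolding slot_stage_def
        proof (rule exI[of _ r], rule exI[of _ E], rule exI[of _ p], rule exI[of _ q], rule exI[of _ b],
            rule exI[of _ W], rule exI[of _ w1], unfold Uw cUw, intro conjI)
          show "Suc (card U) \<le> t" using False Ut by (simp add: U_def)
          show "card (?X - (E \<union> guard r)) < Suc (card U)" using cR by (simp add: R_def)
          show "potential r ?X (insert ?e Y) \<le> 2 * t" using potential_antimono[OF X'] pt le_trans by blast
        qed (use fr star w1Y in auto)
        then show ?thesis using eb eXY by (intro conjI bexI[of _ ?e] disjI1)
      next
        case True
        have "has_copy t (insert ?e Y)"
        proof (rule has_copyI[of p q b "insert w U" "W - insert w U"])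
          \<comment> \<open>Of the \<open>2 * t - 1\<close> star leaves, \<open>t + 1\<close> become
            middle vertices and the rest are the leaves of the copy.\<close>
          show "card (W - insert w U) = t - 2"
            using f(4,5) cUw True UW w(1) finU by (subst card_Diff_subset) auto
          show "{p, b, m} \<in> insert ?e Y" if "m \<in> insert w U" for m using that unfolding U_def by blast
          show "{p, q, m} \<in> insert ?e Y" if "m \<in> insert w U \<union> (W - insert w U)" for m
            using that star w(1) UW by blast
        qed (use f UW w(1) finU cUw True in auto)
        then show ?thesis using eb eXY by (intro conjI bexI[of _ ?e] disjI2[OF disjI2])
      qed
    next
      case False
      define S where "S = W - U"
      let ?K = "(\<lambda>s. {p, b, s}) ` S"
      have "s \<in> S \<Longrightarrow> {p, b, s} \<in> R" for s
        using False kernel_not_guard[OF fr, of s] f(10) unfolding R_def S_def by blast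
      then have KO: "?K \<subseteq> R" by blast
      have cS: "card S = 2 * t - 1 - card U" unfolding S_def using finU UW f(5) by (simp add: card_Diff_subset)
      have cK: "card ?K = card S" using f(2,9) by (intro card_triples) (auto simp: S_def)
      have "card S \<le> card R" using card_mono[OF finR KO] cK by simp
      \<comment> \<open>All leaves outside \<open>U\<close> are blocked by moves in
        \<open>R\<close>, so \<open>2 * t - 1 - card U \<le> card R \<le> card U \<le> t\<close>.
        Hence \<open>U\<close> has size \<open>t\<close>, and \<open>R\<close> has room for one
        further move \<open>g\<close>.\<close>
      then have Ueq: "card U = t" using cS cR Ut t unfolding U_def by linarith
      then have cS': "card S = t - 1" using cS t by simp
      have "card (R - ?K) = card R - card ?K" using KO finR finite_subset by (intro card_Diff_subset) auto
      then have "card (R - ?K) \<le> Suc 0" using cK cS' cR Ueq t by simp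
      then obtain g where g: "R - ?K \<subseteq> {g}"
        using card_le_one_subset_singleton[of "R - ?K"] finR by (metis finite_Diff)
      obtain v where v: "v \<notin> {p, q, b} \<union> W" "v \<notin> \<Union> (?X \<union> Y)"
        using fresh_vertex[of "?X \<union> Y" "{p, q, b} \<union> W"] X' Y f(4) by auto
      let ?e = "{p, q, v}"
      have "threat_stage t ?X (insert ?e Y)"
        unfolding threat_stage_def
      proof (rule exI[of _ r], rule exI[of _ E], rule exI[of _ p], rule exI[of _ q], rule exI[of _ b],
          rule exI[of _ W], rule exI[of _ w1], rule exI[of _ S], rule exI[of _ "{}"], rule exI[of _ ?X],
          rule exI[of _ g], rule exI[of _ v], intro conjI)
        show "w1 \<notin> S" using w1Y f(6) by (simp add: S_def U_def)
        show "?X \<subseteq> E \<union> guard r \<union> ?K \<union> {g}" using g unfolding R_def by blast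
        show "potential r ?X (insert ?e Y) \<le> 2 * t" using potential_antimono[OF X'] pt le_trans by blast
        show "\<forall>w\<in>W - S. {p, b, w} \<in> insert ?e Y" unfolding S_def U_def by blast
        show "\<forall>w\<in>insert v W. {p, q, w} \<in> insert ?e Y" using star by blast
        have "b \<notin> ?e" using f(7,8) v(1) by auto
        then have "{p, b, v} \<noteq> ?e" by blast
        then show "{p, b, v} \<notin> ?X \<union> insert ?e Y" using v(2) by blast
        show "v \<notin> {p, q, b} \<union> W \<union> \<Union> ?X" using v by blast
      qed (use fr cS' in \<open>auto simp: S_def\<close>)
      moreover have "?e \<in> board3" using f(1) v(1) by (intro triple_board3) auto
      moreover have "?e \<notin> ?X \<union> Y" using v(2) by blast
      ultimately show ?thesis by (intro conjI bexI[of _ ?e] disjI2[OF disjI1])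
    qed
  qed
  then show ?thesis using nc by (intro conjI)
qed

lemma threat_step:
  assumes t: "t \<ge> 3" and st: "threat_stage t X Y"
    and X: "finite X" "X \<subseteq> board3" and Y: "finite Y" "Y \<subseteq> board3" and dis: "X \<inter> Y = {}"
    and e: "e \<in> board3" "e \<notin> X \<union> Y"
  shows "\<not> has_copy t (insert e X) \<and>
    (\<exists>e'\<in>board3. e' \<notin> insert e X \<union> Y \<and> (threat_stage t (insert e X) (insert e' Y) \<or> has_copy t (insert e' Y)))"
proof -
  obtain r E p q b W w1 S V X1 g v where fr: "frame t r E p q b W w1"
    and S: "S \<subseteq> W" "card S = t - 1" "w1 \<notin> S" and V: "V \<inter> \<Union> X1 = {}" "p \<notin> V" "b \<notin> V"
    and X1: "X1 \<subseteq> E \<union> guard r \<union> (\<lambda>s. {p, b, s}) ` S \<union> {g}" and Xeq: "X = X1 \<union> (\<lambda>v. {p, b, v}) ` V"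
    and pot: "potential r X Y \<le> 2 * t" and star: "\<forall>w\<in>insert v W. {p, q, w} \<in> Y"
    and slots: "\<forall>w\<in>W - S. {p, b, w} \<in> Y"
    and v: "{p, b, v} \<notin> X \<union> Y" "v \<notin> {p, q, b} \<union> W \<union> \<Union> X1"
    using st unfolding threat_stage_def by blast
  let ?X = "insert e X"
  have f: "p \<noteq> q" "p \<notin> W" "q \<notin> W" "finite W" "card W = 2 * t - 1" "w1 \<in> W" "b \<noteq> p" "b \<noteq> q" "b \<notin> W"
    using fr unfolding frame_def by auto
  have X': "finite ?X" "?X \<subseteq> board3" using X e by auto
  have dis': "?X \<inter> Y = {}" using dis e by blast
  \<comment> \<open>Only a move that ignores the pending threat can raise the potential. One such
    move does not complete a copy, and the second player then completes his own.\<close>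
  have pot': "potential r ?X Y \<le> 2 * t + 1"
    using potential_insert_le[OF fr X, of e Y] pot by linarith
  have w1X: "{p, b, w1} \<notin> ?X" using slots f(6) S(3) dis' by blast
  have nc: "\<not> has_copy t ?X"
  proof (rule no_copy_threats[OF t fr S V X1 _ w1X pot' dis' X'])
    show "?X \<subseteq> X1 \<union> (\<lambda>v. {p, b, v}) ` V \<union> {e}" using Xeq by simp
  qed
  have "\<exists>e'\<in>board3. e' \<notin> ?X \<union> Y \<and> (threat_stage t ?X (insert e' Y) \<or> has_copy t (insert e' Y))"
  proof (cases "e = {p, b, v}")
    case True
    obtain u where u: "u \<notin> {p, q, b} \<union> W" "u \<notin> \<Union> (?X \<union> Y)"
      using fresh_vertex[of "?X \<union> Y" "{p, q, b} \<union> W"] X' Y f(4) by auto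
    let ?e = "{p, q, u}"
    have "threat_stage t ?X (insert ?e Y)"
      unfolding threat_stage_def
    proof (rule exI[of _ r], rule exI[of _ E], rule exI[of _ p], rule exI[of _ q], rule exI[of _ b],
        rule exI[of _ W], rule exI[of _ w1], rule exI[of _ S], rule exI[of _ "insert v V"], rule exI[of _ X1],
        rule exI[of _ g], rule exI[of _ u], intro conjI)
      show "insert v V \<inter> \<Union> X1 = {}" using V v(2) by blast
      show "?X = X1 \<union> (\<lambda>v. {p, b, v}) ` insert v V" using Xeq True by simp
      have "e \<notin> guard r" using kernel_not_guard[OF fr] True by simp
      then have "potential r ?X Y \<le> 2 * t" using potential_insert_outside pot by simp
      then show "potential r ?X (insert ?e Y) \<le> 2 * t" using potential_antimono[OF X'] le_trans by blast
      show "\<forall>w\<in>W - S. {p, b, w} \<in> insert ?e Y" using slots by blast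
      show "\<forall>w\<in>insert u W. {p, q, w} \<in> insert ?e Y" using star by blast
      have "b \<notin> ?e" using f(7,8) u(1) by auto
      then have "{p, b, u} \<noteq> ?e" by blast
      then show "{p, b, u} \<notin> ?X \<union> insert ?e Y" using u(2) by blast
      have "u \<notin> \<Union> X1" using u(2) Xeq by blast
      then show "u \<notin> {p, q, b} \<union> W \<union> \<Union> X1" using u(1) by blast
      show "p \<notin> insert v V" "b \<notin> insert v V" using V v(2) by auto
    qed (fact fr S X1)+
    moreover have "?e \<in> board3" using f(1) u(1) by (intro triple_board3) auto
    moreover have "?e \<notin> ?X \<union> Y" using u(2) by blast
    ultimately show ?thesis by (intro conjI bexI[of _ ?e] disjI1)
  next
    case False
    let ?e = "{p, b, v}"
    have finS: "finite S" using S f(4) finite_subset by blast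
    \<comment> \<open>The copy takes the \<open>t\<close> unblocked leaves and \<open>v\<close> as
      middle vertices and \<open>t - 2\<close> of the \<open>t - 1\<close> blocked ones as
      leaves.\<close>
    have "t - 2 \<le> card S" using S(2) by simp
    then obtain L where L: "L \<subseteq> S" "card L = t - 2"
      by (rule obtain_subset_with_card_n)
    have vW: "v \<notin> W" "v \<noteq> p" "v \<noteq> q" "v \<noteq> b" using v(2) by auto
    have "card (W - S) = t" using S f(5) t finS by (simp add: card_Diff_subset)
    then have cM: "card (insert v (W - S)) = t + 1" using f(4) vW by simp
    have "has_copy t (insert ?e Y)"
    proof (rule has_copyI[of p q b "insert v (W - S)" L])
      show "{p, q, b} \<inter> (insert v (W - S) \<union> L) = {}" using f(2,3,9) vW L(1) S(1) by blast
      show "insert v (W - S) \<inter> L = {}" using vW L S(1) by blast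
      show "finite L" using L finS finite_subset by blast
      show "{p, b, m} \<in> insert ?e Y" if "m \<in> insert v (W - S)" for m using that slots by blast
      show "{p, q, m} \<in> insert ?e Y" if "m \<in> insert v (W - S) \<union> L" for m
        using that star L S(1) by blast
    qed (use f cM L in auto)
    moreover have "?e \<in> board3" using f(7) vW by (intro triple_board3) auto
    moreover have "?e \<notin> ?X \<union> Y" using v(1) False by blast
    ultimately show ?thesis by (intro conjI bexI[of _ ?e] disjI2)
  qed
  then show ?thesis using nc by (intro conjI)
qed

theorem theorem4p2:
  fixes t :: nat
  assumes "t \<ge> 3"
  shows "\<exists>\<sigma>. legal_P2_strategy \<sigma> \<and>
           (\<forall>p. legal_play p \<and> follows_P2 \<sigma> p \<longrightarrow>
                \<not> P1_wins (cone3 (K2ts (t + 1) (t - 2))) p)"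
proof -
  let ?I = "\<lambda>X Y. X = {} \<and> Y = {} \<or> star_stage t X Y \<or> slot_stage t X Y \<or> threat_stage t X Y \<or> has_copy t Y"
  have copy: "contains_copy (cone3 (K2ts (t + 1) (t - 2))) X \<longleftrightarrow> has_copy t X" for X
    unfolding has_copy_def by (rule contains_copy_iff) simp
  show ?thesis
  proof (rule P2_strategy_from_invariant[where I = ?I])
    have "{HubA, Mid 0} \<in> K2ts (t + 1) (t - 2)" by (auto simp: K2ts_def)
    then show "cone3 (K2ts (t + 1) (t - 2)) \<noteq> {}" by (auto simp: cone3_def)
  next
    fix X Y e
    assume I: "?I X Y" and X: "finite X" and Y: "finite Y" and b: "X \<subseteq> board3" "Y \<subseteq> board3"
      and dis: "X \<inter> Y = {}" and e: "e \<in> board3" "e \<notin> X \<union> Y"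
    note args = X b(1) Y b(2) dis e
    have "(has_copy t (insert e X) \<longrightarrow> has_copy t Y) \<and>
      (\<exists>e'\<in>board3. e' \<notin> insert e X \<union> Y \<and> ?I (insert e X) (insert e' Y))"
      using I
    proof (elim disjE)
      assume "X = {} \<and> Y = {}"
      then show ?thesis using start_step[OF assms e(1)] by auto
    next
      assume "star_stage t X Y"
      then show ?thesis using star_step[OF assms _ args] by blast
    next
      assume "slot_stage t X Y"
      then show ?thesis using slot_step[OF assms _ args] by blast
    next
      assume "threat_stage t X Y"
      then show ?thesis using threat_step[OF assms _ args] by blast
    next
      \<comment> \<open>The game is already decided; any free edge keeps this alternative
        true.\<close>
      assume c: "has_copy t Y"
      have "finite (insert e X \<union> Y)" using X Y by simp
      then obtain e' where "e' \<in> board3" "e' \<notin> insert e X \<union> Y"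
        using infinite_board3 by (meson finite_subset subsetI)
      moreover have "has_copy t (insert e' Y)" using c unfolding has_copy_def by blast
      ultimately show ?thesis using c by blast
    qed
    then show "(contains_copy (cone3 (K2ts (t + 1) (t - 2))) (insert e X) \<longrightarrow>
        contains_copy (cone3 (K2ts (t + 1) (t - 2))) Y) \<and>
      (\<exists>e'\<in>board3. e' \<notin> insert e X \<union> Y \<and> ?I (insert e X) (insert e' Y))"
      unfolding copy .
  qed simp
qed

end
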